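(* Let $\alpha\in\mathbb Z^2$ and let $\varphi\in\mathbb C(x_j : j\in\Lambda)$ be a rational solution of the $\mathcal A$-hypergeometric system with exponent $\alpha$. If $\alpha\in I(\mathcal A)$, then $\varphi$ is a constant multiple of the hypergeometric polynomial $\Phi^{\mathcal A}(\alpha;x)$. If $\alpha\notin I(\mathcal A)$, then $\varphi$ is a $\mathbb C$-linear combination of the Laurent polynomials $\Psi^{\mathcal A}_0(\alpha;x)$ and $\Psi^{\mathcal A}_d(\alpha;x)$. In particular, every rational solution is a Laurent polynomial.
   Context: Setting: $m\ge 1$ and $0<k_1<\dots<k_m<d$ are integers with $\gcd(k_1,\dots,k_m,d)=1$; $\Lambda=\{0,k_1,\dots,k_m,d\}$, and all $(m+2)$-tuples are indexed by $\Lambda$. $\mathbb N=\{0,1,2,\dots\}$. $\mathcal A$ is the $2\times(m+2)$ integer matrix whose columns are $(1,j)^T$, $j\in\Lambda$. Variables $x=(x_j)_{j\in\Lambda}$. The $\mathcal A$-hypergeometric system with exponent $\alpha=(\alpha_1,\alpha_2)$ consists of the equations $\prod_{v_j>0}(\partial/\partial x_j)^{v_j}\varphi=\prod_{v_j<0}(\partial/\partial x_j)^{-v_j}\varphi$ for all $v\in\mathbb Z^{\Lambda}$ with $\mathcal A v=0$, together with $\sum_{j\in\Lambda}x_j\,\partial\varphi/\partial x_j=\alpha_1\varphi$ and $\sum_{j\in\Lambda}j\,x_j\,\partial\varphi/\partial x_j=\alpha_2\varphi$. $I(\mathcal A)=\mathcal A\cdot\mathbb N^{\Lambda}\subset\mathbb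 Z^2$. Let $\mathcal B$ be the matrix obtained from $\mathcal A$ by deleting the column $(1,d)^T$, $\mathcal C$ the matrix obtained by deleting the column $(1,0)^T$; $x'=(x_0,x_{k_1},\dots,x_{k_m})$, $\tilde x=(x_{k_1},\dots,x_{k_m},x_d)$. For a matrix $\mathcal M\in\{\mathcal A,\mathcal B,\mathcal C\}$ and $\beta\in\mathbb Z^2$, the hypergeometric polynomial is $\Phi^{\mathcal M}(\beta;y)=\sum_{u}\prod_j y_j^{u_j}/u_j!$, the sum over tuples $u$ of non-negative integers with $\mathcal M u=\beta$ (zero if there are none), where $y$ is the corresponding set of variables ($x$, $x'$, $\tilde x$ respectively). For $\alpha\in\mathbb Z^2$ define the (finite) sums $$\Psi^{\mathcal A}_d(\alpha;x)=\sum_{r\ge1}(-1)^r(r-1)!\,\frac{\Phi^{\mathcal B}(\alpha+r(1,d);x')}{x_d^r},\qquad \Psi^{\mathcal A}_0(\alpha;x)=\sum_{r\ge1}(-1)^r(r-1)!\,\frac{\Phi^{\mathcal C}(\alpha+r(1,0);\tilde x)}{x_0^r}.$$ *)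

theory Defs
  imports Complex_Main "HOL-Library.Poly_Mapping"
    "HOL-Computational_Algebra.Fraction_Field"
begin

text \<open>
  Polynomials over the complex numbers in variables \<open>x\<^sub>0, x\<^sub>1, x\<^sub>2, \<dots>\<close> are finitely supported
  maps from exponent vectors to coefficients. Only the variables indexed by a finite set are
  ever used; the field of rational functions in these is the subset \<open>ratfuns\<close> below.
\<close>

type_synonym mpol = "(nat \<Rightarrow>\<^sub>0 nat) \<Rightarrow>\<^sub>0 complex"
type_synonym ratfun = "mpol fract"

definition mvars :: "mpol \<Rightarrow> nat set" where
  "mvars p = (\<Union>a\<in>Poly_Mapping.keys p. Poly_Mapping.keys a)"

definition ratfuns :: "nat set \<Rightarrow> ratfun set" where
  "ratfuns S = {Fract p q | p q. q \<noteq> 0 \<and> mvars p \<subseteq> S \<and> mvars q \<subseteq> S}"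

definition rf_const :: "complex \<Rightarrow> ratfun" where
  "rf_const c = Fract (Poly_Mapping.single 0 c) 1"

definition rf_var :: "nat \<Rightarrow> ratfun" where
  "rf_var j = Fract (Poly_Mapping.single (Poly_Mapping.single j 1) 1) 1"

text \<open>The coefficient of \<open>x\<^sup>a\<close> in the derivative of \<open>p\<close> comes from the term
  of \<open>p\<close> with exponent \<open>a\<close> raised by one in position \<open>j\<close>.\<close>

lift_definition mp_deriv :: "nat \<Rightarrow> mpol \<Rightarrow> mpol" is
  "\<lambda>j p a. of_nat (Poly_Mapping.lookup a j + 1) * p (a + Poly_Mapping.single j 1)"
proof -
  fix j :: nat and p :: "(nat \<Rightarrow>\<^sub>0 nat) \<Rightarrow> complex"
  assume fin: "finite {a. p a \<noteq> 0}"
  have "inj (\<lambda>a :: nat \<Rightarrow>\<^sub>0 nat. a + Poly_Mapping.single j 1)"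
    by (rule injI) simp
  with fin have "finite ((\<lambda>a. a + Poly_Mapping.single j 1) -` {a. p a \<noteq> 0})"
    by (rule finite_vimageI)
  then show "finite {a. of_nat (Poly_Mapping.lookup a j + 1) * p (a + Poly_Mapping.single j 1) \<noteq> 0}"
    by (rule rev_finite_subset) auto
qed

lemma mp_deriv_add: "mp_deriv j (p + q) = mp_deriv j p + mp_deriv j q"
  by (rule poly_mapping_eqI) (simp add: mp_deriv.rep_eq lookup_add algebra_simps)

lemma mp_deriv_diff: "mp_deriv j (p - q) = mp_deriv j p - mp_deriv j q"
  by (rule poly_mapping_eqI) (simp add: mp_deriv.rep_eq lookup_minus algebra_simps)

lemma mp_deriv_single:
  "mp_deriv j (Poly_Mapping.single a c) =
     Poly_Mapping.single (a - Poly_Mapping.single j 1) (of_nat (Poly_Mapping.lookup a j) * c)"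
proof (rule poly_mapping_eqI)
  fix b :: "nat \<Rightarrow>\<^sub>0 nat"
  let ?e = "Poly_Mapping.single j (1::nat)"
  have 1: "a = b + ?e \<longleftrightarrow> a - ?e = b \<and> Poly_Mapping.lookup a j \<noteq> 0"
  proof
    assume "a = b + ?e"
    then show "a - ?e = b \<and> Poly_Mapping.lookup a j \<noteq> 0" by (simp add: lookup_add)
  next
    assume *: "a - ?e = b \<and> Poly_Mapping.lookup a j \<noteq> 0"
    show "a = b + ?e"
    proof (rule poly_mapping_eqI)
      fix i
      from * have "Poly_Mapping.lookup b i = Poly_Mapping.lookup a i - Poly_Mapping.lookup ?e i" by (auto simp: lookup_minus)
      with * show "Poly_Mapping.lookup a i = Poly_Mapping.lookup (b + ?e) i"
        by (cases "i = j") (auto simp: lookup_add lookup_single when_def)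
    qed
  qed
  show "Poly_Mapping.lookup (mp_deriv j (Poly_Mapping.single a c)) b =
      Poly_Mapping.lookup (Poly_Mapping.single (a - ?e) (of_nat (Poly_Mapping.lookup a j) * c)) b"
  proof (cases "a = b + ?e")
    case True
    then show ?thesis
      by (simp add: mp_deriv.rep_eq lookup_single lookup_add)
  next
    case False
    with 1 have "a - ?e \<noteq> b \<or> Poly_Mapping.lookup a j = 0" by blast
    with False show ?thesis
      by (auto simp: mp_deriv.rep_eq lookup_single when_def)
  qed
qed

lemma mpol_induct [case_names zero add]:
  fixes p :: mpol
  assumes "P 0" and "\<And>a c q. P q \<Longrightarrow> P (Poly_Mapping.single a c + q)"
  shows "P p"
proof (induction p rule: update_induct)
  case const
  then show ?case by (rule assms(1))
next
  case (update q a c)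
  have "Poly_Mapping.update a c q = Poly_Mapping.single a c + q"
    using update by (intro poly_mapping_eqI)
      (auto simp: lookup_update lookup_add lookup_single when_def in_keys_iff)
  with assms(2)[OF update(3)] show ?case by simp
qed

lemma mp_deriv_zero [simp]: "mp_deriv j 0 = 0"
  by (rule poly_mapping_eqI) (simp add: mp_deriv.rep_eq)

lemma mp_deriv_one [simp]: "mp_deriv j 1 = 0"
  by (simp add: mp_deriv_single flip: single_one)

lemma mp_deriv_mult_single:
  "mp_deriv j (Poly_Mapping.single a c * Poly_Mapping.single b d) =
     mp_deriv j (Poly_Mapping.single a c) * Poly_Mapping.single b d +
     Poly_Mapping.single a c * mp_deriv j (Poly_Mapping.single b d)"
proof -
  let ?e = "Poly_Mapping.single j (1::nat)"
  have shift: "a' - ?e + b' = a' + b' - ?e" if "Poly_Mapping.lookup a' j \<noteq> 0" for a' b' :: "nat \<Rightarrow>\<^sub>0 nat"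
    using that by (intro poly_mapping_eqI) (auto simp: lookup_add lookup_minus lookup_single when_def)
  show ?thesis
  proof (cases "Poly_Mapping.lookup a j = 0")
    case True
    have "a + (b - ?e) = a + b - ?e" if "Poly_Mapping.lookup b j \<noteq> 0"
      using shift[OF that, of a] by (simp add: add.commute)
    with True show ?thesis
      by (cases "Poly_Mapping.lookup b j = 0")
        (simp_all add: mult_single mp_deriv_single lookup_add mult_ac)
  next
    case False
    then have 1: "a - ?e + b = a + b - ?e" by (rule shift)
    show ?thesis
    proof (cases "Poly_Mapping.lookup b j = 0")
      case True
      then show ?thesis
        unfolding mult_single mp_deriv_single 1 by (simp add: lookup_add mult_ac)
    next
      case False
      then have 2: "a + (b - ?e) = a + b - ?e" using shift[of b a] by (simp add: add.commute)
      show ?thesis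
        unfolding mult_single mp_deriv_single 1 2
        by (simp add: lookup_add algebra_simps flip: single_add)
    qed
  qed
qed

lemma mp_deriv_mult: "mp_deriv j (p * q) = mp_deriv j p * q + p * mp_deriv j q"
proof -
  have *: "mp_deriv j (Poly_Mapping.single a c * q) =
    mp_deriv j (Poly_Mapping.single a c) * q + Poly_Mapping.single a c * mp_deriv j q" for a c
    by (induction q rule: mpol_induct)
      (simp_all add: distrib_left mp_deriv_add mp_deriv_mult_single add_ac)
  show ?thesis
    by (induction p rule: mpol_induct)
      (simp_all add: distrib_left distrib_right mp_deriv_add * add_ac)
qed

lemma mp_deriv_commute: "mp_deriv i (mp_deriv j p) = mp_deriv j (mp_deriv i p)"
proof (rule poly_mapping_eqI)
  fix a
  have "a + Poly_Mapping.single i 1 + Poly_Mapping.single j (1::nat) =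
      a + Poly_Mapping.single j 1 + Poly_Mapping.single i 1"
    by (simp add: add_ac)
  then show "Poly_Mapping.lookup (mp_deriv i (mp_deriv j p)) a = Poly_Mapping.lookup (mp_deriv j (mp_deriv i p)) a"
    by (cases "i = j") (simp_all add: mp_deriv.rep_eq lookup_add lookup_single mult_ac)
qed

lift_definition rf_deriv :: "nat \<Rightarrow> ratfun \<Rightarrow> ratfun" is
  "\<lambda>j (p, q). (mp_deriv j p * q - p * mp_deriv j q, q * q)"
proof (clarsimp simp del: mult_cancel_left mult_cancel_right)
  fix j and p q p' q' :: mpol
  assume eq: "p * q' = p' * q"
  have "mp_deriv j (p * q') = mp_deriv j (p' * q)" using eq by simp
  then have deq: "mp_deriv j p * q' + p * mp_deriv j q' = mp_deriv j p' * q + p' * mp_deriv j q"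
    by (simp add: mp_deriv_mult)
  have "(mp_deriv j p * q - p * mp_deriv j q) * (q' * q') =
      (mp_deriv j p * q') * (q * q') - (p * q') * (mp_deriv j q * q')"
    by (simp add: algebra_simps)
  also have "\<dots> = (mp_deriv j p * q' - p' * mp_deriv j q) * (q * q')"
    unfolding eq by (simp add: algebra_simps)
  also have "mp_deriv j p * q' - p' * mp_deriv j q = mp_deriv j p' * q - p * mp_deriv j q'"
    using deq by (simp add: algebra_simps)
  also have "(mp_deriv j p' * q - p * mp_deriv j q') * (q * q') =
      (mp_deriv j p' * q') * (q * q) - (p * q') * (mp_deriv j q' * q)"
    by (simp add: algebra_simps)
  also have "\<dots> = (mp_deriv j p' * q' - p' * mp_deriv j q') * (q * q)"
    unfolding eq by (simp add: algebra_simps)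
  finally show "(mp_deriv j p * q - p * mp_deriv j q) * (q' * q') =
      (mp_deriv j p' * q' - p' * mp_deriv j q') * (q * q)" .
qed

lemma rf_deriv_Fract:
  "q \<noteq> 0 \<Longrightarrow> rf_deriv j (Fract p q) = Fract (mp_deriv j p * q - p * mp_deriv j q) (q * q)"
  by (simp only: Fract.abs_eq rf_deriv.abs_eq case_prod_conv fractrel_iff fst_conv snd_conv
      mult_eq_0_iff simp_thms if_False)

lemma rf_deriv_commute: "rf_deriv i (rf_deriv j f) = rf_deriv j (rf_deriv i f)"
proof (cases f rule: Fract_cases)
  case (Fract p q)
  have "mp_deriv i (mp_deriv j p * q - p * mp_deriv j q) * (q * q) -
      (mp_deriv j p * q - p * mp_deriv j q) * mp_deriv i (q * q) =
    mp_deriv j (mp_deriv i p * q - p * mp_deriv i q) * (q * q) -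
      (mp_deriv i p * q - p * mp_deriv i q) * mp_deriv j (q * q)"
    unfolding mp_deriv_diff mp_deriv_mult mp_deriv_commute[of j i] by algebra
  with \<open>q \<noteq> 0\<close> show ?thesis
    by (simp only: \<open>f = Fract p q\<close> rf_deriv_Fract mult_eq_0_iff simp_thms)
qed

lemma rf_deriv_rf_var: "rf_deriv i (rf_var j) = (if i = j then 1 else 0)"
proof -
  have "mp_deriv i (Poly_Mapping.single (Poly_Mapping.single j 1) 1) = (if i = j then 1 else 0)"
    unfolding mp_deriv_single by (simp add: lookup_single)
  then show ?thesis
    unfolding rf_var_def by (simp add: rf_deriv_Fract One_fract_def Zero_fract_def)
qed

lemma rf_deriv_rf_const: "rf_deriv i (rf_const c) = 0"
  by (simp add: rf_const_def rf_deriv_Fract mp_deriv_single Zero_fract_def eq_fract)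

text \<open>The operator \<open>\<Prod>j\<in>S. (\<partial>/\<partial>x\<^sub>j)^(u j)\<close>; the order of the factors is
  immaterial by \<open>rf_deriv_commute\<close>.\<close>

definition diff_op :: "nat set \<Rightarrow> (nat \<Rightarrow> nat) \<Rightarrow> ratfun \<Rightarrow> ratfun" where
  "diff_op S u \<phi> = foldr (\<lambda>j. rf_deriv j ^^ u j) (sorted_list_of_set S) \<phi>"


text \<open>A matrix with columns \<open>(1, j)\<close>, \<open>j \<in> S\<close>, is represented by its index set \<open>S\<close>.\<close>

definition mat_vec :: "nat set \<Rightarrow> (nat \<Rightarrow> int) \<Rightarrow> int \<times> int" where
  "mat_vec S v = (\<Sum>j\<in>S. v j, \<Sum>j\<in>S. int j * v j)"

definition index_set :: "nat \<Rightarrow> (nat \<Rightarrow> nat) \<Rightarrow> nat \<Rightarrow> nat set" where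
  "index_set m k d = {0} \<union> k ` {1..m} \<union> {d}"

definition hypergeometric_solution :: "nat set \<Rightarrow> int \<times> int \<Rightarrow> ratfun \<Rightarrow> bool" where
  "hypergeometric_solution S \<alpha> \<phi> \<longleftrightarrow>
     (\<forall>v :: nat \<Rightarrow> int. mat_vec S v = (0, 0) \<longrightarrow>
        diff_op {j \<in> S. v j > 0} (\<lambda>j. nat (v j)) \<phi> =
        diff_op {j \<in> S. v j < 0} (\<lambda>j. nat (- v j)) \<phi>) \<and>
     (\<Sum>j\<in>S. rf_var j * rf_deriv j \<phi>) = of_int (fst \<alpha>) * \<phi> \<and>
     (\<Sum>j\<in>S. of_nat j * rf_var j * rf_deriv j \<phi>) = of_int (snd \<alpha>) * \<phi>"

definition solution_exponents :: "nat set \<Rightarrow> int \<times> int \<Rightarrow> (nat \<Rightarrow>\<^sub>0 nat) set" where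
  "solution_exponents S \<beta> =
     {u. Poly_Mapping.keys u \<subseteq> S \<and> mat_vec S (\<lambda>j. int (Poly_Mapping.lookup u j)) = \<beta>}"

definition column_monoid :: "nat set \<Rightarrow> (int \<times> int) set" where
  "column_monoid S =
     {mat_vec S (\<lambda>j. int (Poly_Mapping.lookup u j)) | u :: nat \<Rightarrow>\<^sub>0 nat. Poly_Mapping.keys u \<subseteq> S}"

definition hyp_poly :: "nat set \<Rightarrow> int \<times> int \<Rightarrow> ratfun" where
  "hyp_poly S \<beta> = (\<Sum>u\<in>solution_exponents S \<beta>.
     \<Prod>j\<in>S. rf_var j ^ Poly_Mapping.lookup u j / of_nat (fact (Poly_Mapping.lookup u j)))"

text \<open>Only finitely many terms of the series below are nonzero
  (\<open>finite_Psi_d\<close>, \<open>finite_Psi_0\<close>), so summing over the nonzero ones is harmless.\<close>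

definition Psi_d :: "nat set \<Rightarrow> nat \<Rightarrow> int \<times> int \<Rightarrow> ratfun" where
  "Psi_d S d \<alpha> =
     (\<Sum>r | r \<ge> 1 \<and> hyp_poly (S - {d}) (fst \<alpha> + int r, snd \<alpha> + int r * int d) \<noteq> 0.
        (- 1) ^ r * of_nat (fact (r - 1)) *
        hyp_poly (S - {d}) (fst \<alpha> + int r, snd \<alpha> + int r * int d) / rf_var d ^ r)"

definition Psi_0 :: "nat set \<Rightarrow> int \<times> int \<Rightarrow> ratfun" where
  "Psi_0 S \<alpha> =
     (\<Sum>r | r \<ge> 1 \<and> hyp_poly (S - {0}) (fst \<alpha> + int r, snd \<alpha>) \<noteq> 0.
        (- 1) ^ r * of_nat (fact (r - 1)) *
        hyp_poly (S - {0}) (fst \<alpha> + int r, snd \<alpha>) / rf_var 0 ^ r)"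

definition laurent_polynomial :: "nat set \<Rightarrow> ratfun \<Rightarrow> bool" where
  "laurent_polynomial S \<phi> \<longleftrightarrow>
     (\<exists>(E :: (nat \<Rightarrow> int) set) c. finite E \<and>
        \<phi> = (\<Sum>e\<in>E. rf_const (c e) * (\<Prod>j\<in>S. rf_var j powi e j)))"


lemma finite_solution_exponents:
  assumes "finite S"
  shows "finite (solution_exponents S \<beta>)"
proof -
  let ?N = "nat (fst \<beta>)"
  let ?F = "{f. \<forall>j. (j \<in> S \<longrightarrow> f j \<in> {..?N}) \<and> (j \<notin> S \<longrightarrow> f j = (0::nat))}"
  have "finite ?F"
    by (rule finite_set_of_finite_funs) (use assms in auto)
  moreover have "Poly_Mapping.lookup ` solution_exponents S \<beta> \<subseteq> ?F"
  proof clarify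
    fix u j assume u: "u \<in> solution_exponents S \<beta>"
    have "Poly_Mapping.lookup u j \<le> ?N" if "j \<in> S"
    proof -
      have "Poly_Mapping.lookup u j \<le> (\<Sum>i\<in>S. Poly_Mapping.lookup u i)"
        using that assms by (intro member_le_sum) auto
      moreover have "(\<Sum>i\<in>S. int (Poly_Mapping.lookup u i)) = fst \<beta>"
        using u by (auto simp: solution_exponents_def mat_vec_def)
      then have "(\<Sum>i\<in>S. Poly_Mapping.lookup u i) = ?N"
        by (metis nat_int of_nat_sum)
      ultimately show ?thesis by simp
    qed
    moreover have "Poly_Mapping.lookup u j = 0" if "j \<notin> S"
      using u that by (auto simp: solution_exponents_def in_keys_iff)
    ultimately show "(j \<in> S \<longrightarrow> Poly_Mapping.lookup u j \<in> {..?N}) \<and>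
        (j \<notin> S \<longrightarrow> Poly_Mapping.lookup u j = 0)" by simp
  qed
  ultimately have "finite (Poly_Mapping.lookup ` solution_exponents S \<beta>)"
    by (rule finite_subset[rotated])
  then show ?thesis
    by (rule finite_imageD) (simp add: inj_on_def)
qed

lemma hyp_poly_nonzeroE:
  assumes "hyp_poly S \<beta> \<noteq> 0"
  obtains u :: "nat \<Rightarrow> nat" where
    "(\<Sum>j\<in>S. int (u j)) = fst \<beta>" "(\<Sum>j\<in>S. int j * int (u j)) = snd \<beta>"
proof -
  have "solution_exponents S \<beta> \<noteq> {}"
  proof
    assume "solution_exponents S \<beta> = {}"
    then have "hyp_poly S \<beta> = 0" by (simp only: hyp_poly_def sum.empty)
    with assms show False ..
  qed
  then obtain u where "u \<in> solution_exponents S \<beta>" by blast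
  then have "(\<Sum>j\<in>S. int (Poly_Mapping.lookup u j)) = fst \<beta>"
    "(\<Sum>j\<in>S. int j * int (Poly_Mapping.lookup u j)) = snd \<beta>"
    by (auto simp: solution_exponents_def mat_vec_def)
  then show ?thesis by (rule that)
qed

lemma finite_Psi_d:
  assumes "\<And>j. j \<in> S \<Longrightarrow> j \<le> d"
  shows "finite {r. r \<ge> 1 \<and> hyp_poly (S - {d}) (fst \<alpha> + int r, snd \<alpha> + int r * int d) \<noteq> 0}"
proof -
  let ?M = "nat ((int d - 1) * fst \<alpha> - snd \<alpha>)"
  have "{r. r \<ge> 1 \<and> hyp_poly (S - {d}) (fst \<alpha> + int r, snd \<alpha> + int r * int d) \<noteq> 0} \<subseteq> {..?M}"
  proof (rule subsetI, elim CollectE conjE)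
    fix r assume "hyp_poly (S - {d}) (fst \<alpha> + int r, snd \<alpha> + int r * int d) \<noteq> 0"
    then obtain u :: "nat \<Rightarrow> nat" where u: "(\<Sum>j\<in>S - {d}. int (u j)) = fst \<alpha> + int r"
      "(\<Sum>j\<in>S - {d}. int j * int (u j)) = snd \<alpha> + int r * int d"
      by (auto elim: hyp_poly_nonzeroE)
    have "(\<Sum>j\<in>S - {d}. int j * int (u j)) \<le> (\<Sum>j\<in>S - {d}. (int d - 1) * int (u j))"
      using assms by (intro sum_mono mult_right_mono) fastforce+
    then have "snd \<alpha> + int r * int d \<le> (int d - 1) * (fst \<alpha> + int r)"
      by (simp add: u flip: sum_distrib_left)
    then show "r \<in> {..?M}" by (simp add: algebra_simps)
  qed
  then show ?thesis by (rule finite_subset) simp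
qed

lemma finite_Psi_0:
  "finite {r. r \<ge> 1 \<and> hyp_poly (S - {0}) (fst \<alpha> + int r, snd \<alpha>) \<noteq> 0}"
proof -
  let ?M = "nat (snd \<alpha> - fst \<alpha>)"
  have "{r. r \<ge> 1 \<and> hyp_poly (S - {0}) (fst \<alpha> + int r, snd \<alpha>) \<noteq> 0} \<subseteq> {..?M}"
  proof (rule subsetI, elim CollectE conjE)
    fix r assume "hyp_poly (S - {0}) (fst \<alpha> + int r, snd \<alpha>) \<noteq> 0"
    then obtain u :: "nat \<Rightarrow> nat" where u: "(\<Sum>j\<in>S - {0}. int (u j)) = fst \<alpha> + int r"
      "(\<Sum>j\<in>S - {0}. int j * int (u j)) = snd \<alpha>"
      by (auto elim: hyp_poly_nonzeroE)
    have "(\<Sum>j\<in>S - {0}. 1 * int (u j)) \<le> (\<Sum>j\<in>S - {0}. int j * int (u j))"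
      by (intro sum_mono mult_right_mono) auto
    then show "r \<in> {..?M}" using u by simp
  qed
  then show ?thesis by (rule finite_subset) simp
qed


end

theory Submission
  imports Defs "HOL-Computational_Algebra.Polynomial_FPS"
    "HOL-Computational_Algebra.Fundamental_Theorem_Algebra"
begin

text \<open>
  Every rational solution is expanded into a formal Laurent series, and the system is solved
  coefficient by coefficient.

  Write the solution as \<open>\<phi> = p / q\<close>. For a weight on exponents that separates the monomials
  of \<open>q\<close>, the equation \<open>q f = p\<close> has exactly one solution \<open>f\<close> among the series whose
  exponents have weight bounded below (\<open>expansion_exists\<close>, \<open>expands_unique\<close>). The weight is chosen
  such that the interior variables \<open>x\<^sub>k\<close>, \<open>0 < k < d\<close>, count as small compared with
  \<open>x\<^sub>0\<close> and \<open>x\<^sub>d\<close>. The Euler equations confine the support of \<open>f\<close> to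
  the exponents \<open>a\<close> with \<open>A a = \<alpha>\<close>, and the toric equations become two-term relations
  \<open>f a * (\<Prod>j. \<Prod>i\<in>{b j<..a j}. i) = f b * (\<Prod>j. \<Prod>i\<in>{a j<..b j}. i)\<close> between exponents of
  that kind. So it only matters which coordinates of an exponent are negative.

  An interior coordinate of an exponent in the support is never negative, because otherwise the
  relations would produce exponents of arbitrarily small weight (\<open>interior_nonneg\<close>). The
  coordinates at \<open>0\<close> and \<open>d\<close> are never both negative (\<open>no_doubly_negative\<close>).
  Indeed, along a line in direction \<open>d e\<^sub>k - (d - k) e\<^sub>0 - k e\<^sub>d\<close> the coefficients would be,
  up to sign and a constant, of the form \<open>(A + u l)! (B + v l)! / (c + (u + v) l)!\<close>. Such a sequence
  grows like \<open>\<rho>\<^sup>l l\<^sup>\<gamma>\<close> with \<open>\<gamma> - 1/2\<close> an integer, reflecting the square root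
  branching of the solutions along the discriminant, whereas the coefficients of a rational
  function satisfy a linear recurrence. The contradiction is obtained algebraically: the
  recurrence is a polynomial identity in \<open>l\<close>, and it fails at \<open>l = - 1\<close>
  (\<open>no_linear_recurrence\<close>).

  What remains are exponents whose negative coordinates form one of the sets \<open>{}\<close>, \<open>{0}\<close> and
  \<open>{d}\<close>. There are finitely many of them, and on each of the three classes the relations
  determine the coefficients up to a common factor; the resulting series are the expansions
  of \<open>\<Phi>\<close>, \<open>\<Psi>\<^sub>0\<close> and \<open>\<Psi>\<^sub>d\<close>. If \<open>\<alpha>\<close> lies in the column monoid, there is an
  exponent in \<open>\<nat>\<^sup>\<Lambda>\<close>, and the relation between it and an exponent with a negative coordinate
  forces the coefficient of the latter to vanish. Otherwise the class of \<open>{}\<close> is empty.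
\<close>

section \<open>Linear recurrences and quotients of factorials\<close>

text \<open>
  Replacing every root \<open>x\<close> of a polynomial by \<open>x ^ N\<close> gives a multiple of it that
  only involves powers of \<open>X ^ N\<close>. This is what lets one extract an arithmetic progression
  from a linear recurrence.
\<close>

lemma linear_dvd_power_diff:
  fixes x :: "'a :: comm_ring_1"
  shows "[:- x, 1:] dvd monom 1 N - [:x ^ N:]"
proof -
  have "[:0, 1:] - [:x:] dvd [:0, 1:] ^ N - [:x:] ^ N"
    by (subst power_diff_sumr2) (rule dvd_triv_left)
  then show ?thesis
    by (simp add: monom_altdef poly_const_pow)
qed

lemma poly_dvd_poly_in_power:
  fixes h :: "complex poly"
  assumes "h \<noteq> 0" "N \<ge> 1"
  shows "\<exists>E. E \<noteq> 0 \<and> h dvd pcompose E (monom 1 N)"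
proof -
  obtain A where A: "h = smult (lead_coeff h) (\<Prod>x\<in>#A. [:- x, 1:])"
    using alg_closed_imp_factorization[OF assms(1)] by blast
  have "\<exists>E. E \<noteq> 0 \<and> (\<Prod>x\<in>#A. [:- x, 1:]) dvd pcompose E (monom 1 N)"
  proof (induction A)
    case empty
    show ?case by (intro exI[of _ 1]) (simp add: pcompose_1)
  next
    case (add x A)
    then obtain E where E: "E \<noteq> 0" "(\<Prod>x\<in>#A. [:- x, 1:]) dvd pcompose E (monom 1 N)"
      by blast
    have "pcompose [:- (x ^ N), 1:] (monom 1 N) = monom 1 N - [:x ^ N:]"
      by (simp add: pcompose_pCons)
    then have "[:- x, 1:] * (\<Prod>x\<in>#A. [:- x, 1:]) dvd pcompose ([:- (x ^ N), 1:] * E) (monom 1 N)"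
      unfolding pcompose_mult using E(2) linear_dvd_power_diff[of x N] by (metis mult_dvd_mono)
    moreover have "[:- (x ^ N), 1:] * E \<noteq> 0"
      using E(1) by (metis mult_eq_0_iff one_neq_zero pCons_eq_0_iff)
    ultimately show ?case by (intro exI[of _ "[:- (x ^ N), 1:] * E"]) (simp del: mult_pCons_left)
  qed
  then obtain E where "E \<noteq> 0" "(\<Prod>x\<in>#A. [:- x, 1:]) dvd pcompose E (monom 1 N)" by blast
  then show ?thesis
    using A assms(1) by (metis leading_coeff_0_iff smult_dvd_iff)
qed

lemma pcompose_monom_eq_sum:
  "pcompose E (monom (1 :: 'a :: comm_ring_1) N) = (\<Sum>i\<le>degree E. monom (coeff E i) (N * i))"
proof -
  have "pcompose E (monom 1 N) = pcompose (\<Sum>i\<le>degree E. monom (coeff E i) i) (monom 1 N)"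
    by (simp add: poly_as_sum_of_monoms)
  also have "\<dots> = (\<Sum>i\<le>degree E. monom (coeff E i) (N * i))"
    unfolding pcompose_sum
    by (intro sum.cong refl)
      (simp add: pcompose_altdef map_poly_monom poly_monom monom_power smult_monom)
  finally show ?thesis .
qed

lemma fps_monom_mult_nth:
  "fps_nth (fps_of_poly (monom c k) * F) n = (if n < k then 0 else c * fps_nth F (n - k))"
  for F :: "'a :: comm_ring_1 fps"
  by (simp add: fps_of_poly_monom mult.assoc fps_X_power_mult_nth)

text \<open>
  The coefficients of a rational power series satisfy a linear recurrence, and so does each
  of their sections along an arithmetic progression: multiplying the denominator \<open>h\<close> up to a
  polynomial in \<open>X ^ N\<close> decouples the residue classes modulo \<open>N\<close>. The coefficients
  \<open>g\<close> are those of that polynomial in reversed order, so that \<open>g 0\<close> is its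
  leading coefficient.
\<close>

lemma section_recurrence:
  fixes F :: "complex fps" and h :: "complex poly"
  assumes "h \<noteq> 0" "N \<ge> 1"
    and van: "\<And>n. n \<ge> n1 \<Longrightarrow> fps_nth (fps_of_poly h * F) n = 0"
  shows "\<exists>g r l0. g 0 \<noteq> 0 \<and> (\<forall>l\<ge>l0. (\<Sum>i\<le>r. g i * fps_nth F (n0 + N * (l + i))) = 0)"
proof -
  obtain E s where E: "E \<noteq> 0" "pcompose E (monom 1 N) = h * s"
    using poly_dvd_poly_in_power[OF assms(1,2)] by (metis dvdE)
  define r where "r = degree E"
  have *: "(\<Sum>i\<le>r. coeff E (r - i) * fps_nth F (n0 + N * (l + i))) = 0" if l: "l \<ge> n1 + degree s" for l
  proof -
    let ?n = "n0 + N * (l + r)"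
    have "(n1 + degree s) * 1 \<le> (l + r) * N"
      using l assms(2) by (intro mult_le_mono) auto
    then have nl: "?n \<ge> n1 + degree s" by (simp add: mult.commute)
    have z: "fps_nth (fps_of_poly s * (fps_of_poly h * F)) ?n = 0"
    proof (subst fps_mult_nth, rule sum.neutral, intro ballI)
      fix i assume i: "i \<in> {0..?n}"
      show "fps_nth (fps_of_poly s) i * fps_nth (fps_of_poly h * F) (?n - i) = 0"
      proof (cases "i \<le> degree s")
        case True
        then have "?n - i \<ge> n1" using nl by linarith
        then show ?thesis using van by simp
      qed (simp add: coeff_eq_0)
    qed
    have "fps_of_poly s * (fps_of_poly h * F) = fps_of_poly (pcompose E (monom 1 N)) * F"
      by (simp add: E(2) fps_of_poly_mult mult_ac)
    with z have "0 = fps_nth (fps_of_poly (pcompose E (monom 1 N)) * F) ?n" by simp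
    also have "\<dots> = (\<Sum>i\<le>r. fps_nth (fps_of_poly (monom (coeff E i) (N * i)) * F) ?n)"
      by (simp only: pcompose_monom_eq_sum fps_of_poly_sum sum_distrib_right fps_sum_nth r_def)
    also have "\<dots> = (\<Sum>i\<le>r. coeff E i * fps_nth F (n0 + N * (l + (r - i))))"
    proof (rule sum.cong)
      fix i assume "i \<in> {..r}"
      then have "l + r = i + (l + (r - i))" by simp
      then have "N * (l + r) = N * i + N * (l + (r - i))" by (metis distrib_left)
      then have "?n = N * i + (n0 + N * (l + (r - i)))" by simp
      then show "fps_nth (fps_of_poly (monom (coeff E i) (N * i)) * F) ?n =
          coeff E i * fps_nth F (n0 + N * (l + (r - i)))"
        unfolding fps_monom_mult_nth by simp
    qed simp
    also have "\<dots> = (\<Sum>i\<le>r. coeff E (r - i) * fps_nth F (n0 + N * (l + i)))"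
      by (rule sum.reindex_bij_witness[of _ "\<lambda>i. r - i" "\<lambda>i. r - i"]) auto
    finally show ?thesis by simp
  qed
  have "coeff E (r - 0) \<noteq> 0" using E(1) by (simp add: r_def)
  with * show ?thesis by (intro exI[of _ "\<lambda>i. coeff E (r - i)"] exI[of _ r] exI[of _ "n1 + degree s"]) auto
qed

text \<open>
  Dividing the recurrence by \<open>C l\<close> and clearing denominators turns it into the vanishing of
  a polynomial in \<open>l\<close> at all large integers, hence everywhere. At \<open>l = - 1\<close> every
  summand with \<open>i > 0\<close> contains the factor \<open>l + 1\<close>, so only the summand
  \<open>i = 0\<close> survives there, and it is a product of values of \<open>B\<close> at integers.
\<close>

lemma no_linear_recurrence:
  fixes A B :: "complex poly" and C g :: "nat \<Rightarrow> complex"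
  assumes nz: "\<And>l. C l \<noteq> 0"
    and rec: "\<And>l. poly B (of_nat l) * C (Suc l) = of_nat (Suc l) * poly A (of_nat l) * C l"
    and B: "\<And>i :: int. poly B (of_int i) \<noteq> 0"
    and g: "g 0 \<noteq> 0" and lin: "\<And>l. l \<ge> l0 \<Longrightarrow> (\<Sum>i\<le>r. g i * C (l + i)) = 0"
  shows False
proof -
  \<comment> \<open>The polynomials \<open>a s\<close> and \<open>b s\<close> are numerator and denominator of
    \<open>C (l + s + 1) / C (l + s)\<close> as functions of \<open>l\<close>.\<close>
  define a where "a s = [:of_nat (Suc s), 1:] * pcompose A [:of_nat s, 1:]" for s
  define b where "b s = pcompose B [:of_nat s, 1:]" for s
  define P where "P = (\<Sum>i\<le>r. smult (g i) ((\<Prod>s<i. a s) * (\<Prod>s=i..<r. b s)))"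
  have pa: "poly (a s) x = (x + of_nat (Suc s)) * poly A (x + of_nat s)" for s x
    by (simp add: a_def poly_pcompose algebra_simps)
  have pb: "poly (b s) x = poly B (x + of_nat s)" for s x
    by (simp add: b_def poly_pcompose add_ac)
  have step: "(\<Prod>s<i. poly (b s) (of_nat l)) * C (l + i) = (\<Prod>s<i. poly (a s) (of_nat l)) * C l" for l i
  proof (induction i)
    case (Suc i)
    have "(\<Prod>s<Suc i. poly (b s) (of_nat l)) * C (l + Suc i) =
        (\<Prod>s<i. poly (b s) (of_nat l)) * (poly B (of_nat (l + i)) * C (Suc (l + i)))"
      by (simp add: pb)
    also have "\<dots> = (of_nat (Suc (l + i)) * poly A (of_nat (l + i))) * ((\<Prod>s<i. poly (b s) (of_nat l)) * C (l + i))"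
      by (subst rec) (simp only: mult_ac)
    also have "\<dots> = (\<Prod>s<Suc i. poly (a s) (of_nat l)) * C l"
      by (subst Suc.IH) (simp add: pa mult_ac add_ac)
    finally show ?case .
  qed simp
  have zero: "poly P (of_nat l) = 0" if "l \<ge> l0" for l
  proof -
    have "poly P (of_nat l) * C l = (\<Sum>i\<le>r. g i * ((\<Prod>s<i. poly (a s) (of_nat l)) * C l) * (\<Prod>s=i..<r. poly (b s) (of_nat l)))"
      by (simp add: P_def poly_sum poly_prod sum_distrib_left mult_ac)
    also have "\<dots> = (\<Sum>i\<le>r. (\<Prod>s<r. poly (b s) (of_nat l)) * (g i * C (l + i)))"
    proof (rule sum.cong)
      fix i assume i: "i \<in> {..r}"
      then have "{..<r} = {..<i} \<union> {i..<r}" "{..<i} \<inter> {i..<r} = {}" by auto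
      then have "(\<Prod>s<r. poly (b s) (of_nat l)) = (\<Prod>s<i. poly (b s) (of_nat l)) * (\<Prod>s=i..<r. poly (b s) (of_nat l))"
        by (simp add: prod.union_disjoint)
      then show "g i * ((\<Prod>s<i. poly (a s) (of_nat l)) * C l) * (\<Prod>s=i..<r. poly (b s) (of_nat l)) =
          (\<Prod>s<r. poly (b s) (of_nat l)) * (g i * C (l + i))"
        unfolding step[symmetric] by simp
    qed simp
    also have "\<dots> = 0" using lin[OF that] by (simp flip: sum_distrib_left)
    finally show ?thesis using nz by simp
  qed
  have "P = 0"
  proof (rule ccontr)
    assume "P \<noteq> 0"
    then have "finite {x. poly P x = 0}" by (rule poly_roots_finite)
    then have "finite ((of_nat :: nat \<Rightarrow> complex) ` {l0..})"
      by (rule rev_finite_subset) (use zero in auto)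
    then show False
      using finite_imageD[of "of_nat :: nat \<Rightarrow> complex" "{l0..}"] infinite_Ici[of l0]
      by (auto simp: inj_on_def)
  qed
  have vanish: "(\<Prod>s<i. poly (a s) (- 1)) = 0" if "i \<noteq> 0" for i
    using that by (intro prod_zero) (auto simp: pa intro!: bexI[of _ 0])
  have "poly P (- 1) = (\<Sum>i\<le>r. if i = 0 then g 0 * (\<Prod>s<r. poly (b s) (- 1)) else 0)"
    unfolding P_def poly_sum by (intro sum.cong refl) (auto simp: vanish poly_prod atLeast0LessThan)
  also have "\<dots> = g 0 * (\<Prod>s<r. poly (b s) (- 1))" by simp
  also have "\<dots> \<noteq> 0"
  proof -
    have "poly (b s) (- 1) \<noteq> 0" for s
      using B[of "int s - 1"] by (simp add: pb)
    with g show ?thesis by simp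
  qed
  finally show False using \<open>P = 0\<close> by simp
qed

text \<open>
  Among the \<open>N\<close> consecutive linear factors of such a block exactly one is divisible by
  \<open>N\<close>, namely \<open>N * (l + 1)\<close>; none of the others vanishes at an integer.
\<close>

lemma prod_block_factor:
  fixes c N :: int
  assumes "0 \<le> c" "c < N"
  shows "\<exists>R :: complex poly. (\<forall>i. poly R (of_int i) \<noteq> 0) \<and>
    (\<forall>l. (\<Prod>i\<in>{c + N * int l<..c + N * (int l + 1)}. of_int i) =
      of_int N * of_nat (Suc l) * poly R (of_nat l))"
proof -
  define R :: "complex poly" where "R = (\<Prod>r\<in>{1..N} - {N - c}. [:of_int (c + r), of_int N:])"
  have 1: "poly R (of_int i) \<noteq> 0" for i
  proof
    assume "poly R (of_int i) = 0"
    then have "(\<Prod>r\<in>{1..N} - {N - c}. poly [:of_int (c + r), of_int N:] (of_int i)) = (0 :: complex)"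
      by (simp only: R_def poly_prod)
    moreover have fin: "finite ({1..N} - {N - c})" by simp
    ultimately obtain r where r: "r \<in> {1..N} - {N - c}" "poly [:of_int (c + r), of_int N:] (of_int i) = (0 :: complex)"
      by (simp only: prod_zero_iff[OF fin]) blast
    have "of_int (c + r + i * N) = (0 :: complex)" using r(2) by simp
    then have eq: "c + r = N * (- i)" by (simp only: of_int_eq_0_iff) (simp add: algebra_simps)
    have "N * 0 < N * (- i)" "N * (- i) < N * 2"
      using eq r(1) assms by auto
    moreover have N: "N > 0" using assms by simp
    ultimately have "0 < - i" "- i < 2" by (simp_all only: mult_less_cancel_left_pos[OF N])
    then have "- i = 1" by simp
    then have "c + r = N" using eq by simp
    then show False using r(1) by auto
  qed
  have 2: "(\<Prod>i\<in>{c + N * int l<..c + N * (int l + 1)}. of_int i) =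
      of_int N * of_nat (Suc l) * poly R (of_nat l)" for l
  proof -
    have "(\<Prod>i\<in>{c + N * int l<..c + N * (int l + 1)}. of_int i :: complex) =
        (\<Prod>r\<in>{1..N}. of_int (c + N * int l + r))"
      by (rule prod.reindex_bij_witness[of _ "\<lambda>r. c + N * int l + r" "\<lambda>i. i - (c + N * int l)"])
        (auto simp: algebra_simps)
    also have "\<dots> = of_int (c + N * int l + (N - c)) * (\<Prod>r\<in>{1..N} - {N - c}. of_int (c + N * int l + r))"
      by (rule prod.remove) (use assms in auto)
    also have "(\<Prod>r\<in>{1..N} - {N - c}. of_int (c + N * int l + r)) = poly R (of_nat l)"
      by (simp add: R_def poly_prod algebra_simps)
    also have "of_int (c + N * int l + (N - c)) = (of_int N * of_nat (Suc l) :: complex)"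
      by (simp add: algebra_simps)
    finally show ?thesis .
  qed
  show ?thesis using 1 2 by blast
qed

text \<open>
  Up to the powers of \<open>\<sigma>\<close> the sequence is a multiple of
  \<open>(c1 + u l)! (c2 + v l)! / (c + N l)!\<close>. When \<open>N = u + v\<close>, Stirling's
  formula gives it a growth \<open>\<rho>\<^sup>l\<close> times a power of \<open>l\<close> with half-integral exponent,
  which no rational generating function has. The algebraic form of this obstruction is that the
  quotient of successive terms has a double zero and only a simple pole at \<open>l = - 1\<close>.
\<close>

lemma factorial_quotient_no_linear_recurrence:
  fixes C g :: "nat \<Rightarrow> complex" and c c1 c2 N u v :: int
  assumes c: "0 \<le> c" "c < N" "0 \<le> c1" "c1 < u" "0 \<le> c2" "c2 < v" and "\<sigma> \<noteq> 0"
    and nz: "\<And>l. C l \<noteq> 0"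
    and rec: "\<And>l. C (Suc l) * (\<Prod>i\<in>{c + N * int l<..c + N * (int l + 1)}. of_int i) =
      C l * (\<sigma> * (\<Prod>i\<in>{c1 + u * int l<..c1 + u * (int l + 1)}. of_int i) *
        (\<Prod>i\<in>{c2 + v * int l<..c2 + v * (int l + 1)}. of_int i))"
    and g: "g 0 \<noteq> 0" and lin: "\<And>l. l \<ge> l0 \<Longrightarrow> (\<Sum>i\<le>r. g i * C (l + i)) = 0"
  shows False
proof -
  obtain R :: "complex poly" where R: "\<And>i. poly R (of_int i) \<noteq> 0"
    "\<And>l. (\<Prod>i\<in>{c + N * int l<..c + N * (int l + 1)}. of_int i) = of_int N * of_nat (Suc l) * poly R (of_nat l)"
    using prod_block_factor[OF c(1,2)] by blast
  obtain R1 :: "complex poly" where R1: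
    "\<And>l. (\<Prod>i\<in>{c1 + u * int l<..c1 + u * (int l + 1)}. of_int i) = of_int u * of_nat (Suc l) * poly R1 (of_nat l)"
    using prod_block_factor[OF c(3,4)] by blast
  obtain R2 :: "complex poly" where R2:
    "\<And>l. (\<Prod>i\<in>{c2 + v * int l<..c2 + v * (int l + 1)}. of_int i) = of_int v * of_nat (Suc l) * poly R2 (of_nat l)"
    using prod_block_factor[OF c(5,6)] by blast
  define A where "A = smult (\<sigma> * of_int u * of_int v) (R1 * R2)"
  define B where "B = smult (of_int N) R"
  show False
  proof (rule no_linear_recurrence[of C B A g l0 r])
    fix l
    have "of_nat (Suc l) * (poly B (of_nat l) * C (Suc l)) =
        of_nat (Suc l) * (of_nat (Suc l) * poly A (of_nat l) * C l)"
      using rec[of l] unfolding R R1 R2 A_def B_def by (simp add: mult_ac del: of_nat_Suc)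
    then show "poly B (of_nat l) * C (Suc l) = of_nat (Suc l) * poly A (of_nat l) * C l"
      by (simp del: of_nat_Suc)
  next
    show "poly B (of_int i) \<noteq> 0" for i using R(1) c by (simp add: B_def)
  qed (use nz g lin in auto)
qed

section \<open>Polynomials acting on formal Laurent series\<close>

text \<open>
  A series is an arbitrary family of coefficients indexed by integer exponent vectors.
  Polynomials act on such families by convolution, which only needs finite sums; in this way
  no ring of Laurent series has to be constructed, and \<open>f\<close> is an expansion of
  \<open>p / q\<close> if \<open>q\<close> acting on \<open>f\<close> gives \<open>p\<close>.
\<close>

type_synonym series = "(nat \<Rightarrow> int) \<Rightarrow> complex"

definition act :: "mpol \<Rightarrow> series \<Rightarrow> series" where
  "act q f a = (\<Sum>b\<in>Poly_Mapping.keys q. Poly_Mapping.lookup q b * f (\<lambda>j. a j - int (Poly_Mapping.lookup b j)))"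

definition one_series :: series where
  "one_series a = (if a = (\<lambda>_. 0) then 1 else 0)"

definition series_deriv :: "nat \<Rightarrow> series \<Rightarrow> series" where
  "series_deriv j f a = of_int (a j + 1) * f (a(j := a j + 1))"

lemma act_single: "act (Poly_Mapping.single b c) f = (\<lambda>a. c * f (\<lambda>j. a j - int (Poly_Mapping.lookup b j)))"
  by (cases "c = 0") (auto simp: act_def)

lemma act_add_left: "act (p + q) f = (\<lambda>a. act p f a + act q f a)"
proof
  fix a
  show "act (p + q) f a = act p f a + act q f a"
    unfolding act_def
    by (rule setsum_keys_plus_distrib[where f = "\<lambda>b x. x * f (\<lambda>j. a j - int (Poly_Mapping.lookup b j))"])
      (simp_all add: distrib_right)
qed

lemma act_zero_left [simp]: "act 0 f = (\<lambda>_. 0)"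
  by (simp add: act_def fun_eq_iff)

lemma act_zero_right [simp]: "act q (\<lambda>_. 0) = (\<lambda>_. 0)"
  by (simp add: act_def fun_eq_iff)

lemma act_add: "act q (\<lambda>a. f a + g a) = (\<lambda>a. act q f a + act q g a)"
  by (simp add: act_def fun_eq_iff distrib_left sum.distrib)

lemma act_scale: "act q (\<lambda>a. c * f a) = (\<lambda>a. c * act q f a)"
  by (simp add: act_def fun_eq_iff sum_distrib_left mult_ac)

lemma act_diff: "act q (\<lambda>a. f a - g a) = (\<lambda>a. act q f a - act q g a)"
  using act_add[of q f "\<lambda>a. (- 1) * g a"] unfolding act_scale by simp

lemma act_diff_left: "act (p - q) f = (\<lambda>a. act p f a - act q f a)"
  using act_add_left[of "p - q" q f] by (simp add: fun_eq_iff)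

lemma act_mult: "act (p * q) f = act p (act q f)"
proof -
  have *: "act (Poly_Mapping.single b c * q) f = act (Poly_Mapping.single b c) (act q f)" for b c
  proof (induction q rule: mpol_induct)
    case (add b' c' q)
    then show ?case
      by (simp add: distrib_left act_add_left act_add mult_single act_single lookup_add
          fun_eq_iff algebra_simps)
  qed simp
  show ?thesis
    by (induction p rule: mpol_induct) (simp_all add: distrib_right act_add_left *)
qed

lemma act_commute: "act p (act q f) = act q (act p f)"
  by (simp add: mult.commute flip: act_mult)

lemma act_one_series: "act p one_series (\<lambda>j. int (Poly_Mapping.lookup b j)) = Poly_Mapping.lookup p b"
proof -
  have "act p one_series (\<lambda>j. int (Poly_Mapping.lookup b j)) =
      (\<Sum>b'\<in>Poly_Mapping.keys p. if b' = b then Poly_Mapping.lookup p b' else 0)"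
    unfolding act_def
  proof (rule sum.cong)
    fix b'
    have "(\<lambda>j. int (Poly_Mapping.lookup b j) - int (Poly_Mapping.lookup b' j)) = (\<lambda>_. 0) \<longleftrightarrow> b' = b"
      by (auto simp: fun_eq_iff poly_mapping_eq_iff)
    then show "Poly_Mapping.lookup p b' * one_series (\<lambda>j. int (Poly_Mapping.lookup b j) - int (Poly_Mapping.lookup b' j)) =
        (if b' = b then Poly_Mapping.lookup p b' else 0)"
      by (simp add: one_series_def)
  qed simp
  also have "\<dots> = Poly_Mapping.lookup p b" by (simp add: in_keys_iff)
  finally show ?thesis .
qed

lemma act_one_series_nonzeroE:
  assumes "act p one_series a \<noteq> 0"
  obtains b where "b \<in> Poly_Mapping.keys p" "a = (\<lambda>j. int (Poly_Mapping.lookup b j))"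
proof -
  obtain b where b: "b \<in> Poly_Mapping.keys p"
    "Poly_Mapping.lookup p b * one_series (\<lambda>j. a j - int (Poly_Mapping.lookup b j)) \<noteq> 0"
    using assms unfolding act_def by (meson sum.neutral)
  then have "(\<lambda>j. a j - int (Poly_Mapping.lookup b j)) = (\<lambda>_. 0)"
    by (auto simp: one_series_def split: if_splits)
  then show thesis using b(1) by (intro that[of b]) (auto simp: fun_eq_iff)
qed

lemma act_one_series_eq_0:
  assumes "act p one_series = (\<lambda>_. 0)" shows "p = 0"
  by (rule poly_mapping_eqI) (use assms in \<open>simp flip: act_one_series\<close>)

lemma series_deriv_add: "series_deriv j (\<lambda>a. f a + g a) = (\<lambda>a. series_deriv j f a + series_deriv j g a)"
  by (simp add: series_deriv_def fun_eq_iff distrib_left)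

lemma series_deriv_one_series: "series_deriv j one_series = (\<lambda>_. 0)"
proof
  fix a :: "nat \<Rightarrow> int"
  show "series_deriv j one_series a = 0"
  proof (cases "a(j := a j + 1) = (\<lambda>_. 0)")
    case True
    then have "a j + 1 = 0" by (metis fun_upd_same)
    then show ?thesis unfolding series_deriv_def by (simp only: of_int_0 mult_zero_left)
  qed (simp add: series_deriv_def one_series_def)
qed

text \<open>
  The Leibniz rule, which makes expansion compatible with differentiation.
\<close>

lemma series_deriv_act:
  "series_deriv j (act q f) = (\<lambda>a. act (mp_deriv j q) f a + act q (series_deriv j f) a)"
proof (induction q rule: mpol_induct)
  case zero
  show ?case by (simp add: series_deriv_def fun_eq_iff)
next
  case (add b c q)
  have "series_deriv j (act (Poly_Mapping.single b c) f) a =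
      act (mp_deriv j (Poly_Mapping.single b c)) f a +
      act (Poly_Mapping.single b c) (series_deriv j f) a" for a
  proof (cases "Poly_Mapping.lookup b j = 0")
    case True
    then have "(\<lambda>i. (a(j := a j + 1)) i - int (Poly_Mapping.lookup b i)) =
        (\<lambda>i. a i - int (Poly_Mapping.lookup b i))(j := a j + 1)" by auto
    with True show ?thesis
      by (simp add: series_deriv_def act_single mp_deriv_single)
  next
    case False
    have 1: "(\<lambda>i. (a(j := a j + 1)) i - int (Poly_Mapping.lookup b i)) =
        (\<lambda>i. a i - int (Poly_Mapping.lookup b i))(j := a j - int (Poly_Mapping.lookup b j) + 1)" by auto
    have 2: "(\<lambda>i. a i - int (Poly_Mapping.lookup (b - Poly_Mapping.single j 1) i)) =
        (\<lambda>i. a i - int (Poly_Mapping.lookup b i))(j := a j - int (Poly_Mapping.lookup b j) + 1)"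
      using False by (auto simp: lookup_minus lookup_single when_def of_nat_diff)
    show ?thesis
      unfolding series_deriv_def act_single mp_deriv_single 1 2 by (simp add: algebra_simps)
  qed
  then have s: "series_deriv j (act (Poly_Mapping.single b c) f) =
      (\<lambda>a. act (mp_deriv j (Poly_Mapping.single b c)) f a +
      act (Poly_Mapping.single b c) (series_deriv j f) a)" by (rule ext)
  show ?case
    unfolding act_add_left mp_deriv_add series_deriv_add s add by (simp add: add_ac)
qed

section \<open>Expansions of rational functions\<close>

lemma rf_const_add: "rf_const (x + y) = rf_const x + rf_const y"
  by (simp add: rf_const_def single_add)

lemma rf_const_mult: "rf_const (x * y) = rf_const x * rf_const y"
  by (simp add: rf_const_def mult_single)

lemma rf_const_0 [simp]: "rf_const 0 = 0"
  by (simp add: rf_const_def Zero_fract_def)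

lemma rf_const_1 [simp]: "rf_const 1 = 1"
  by (simp add: rf_const_def One_fract_def)

lemma rf_const_of_nat: "rf_const (of_nat n) = of_nat n"
  by (induction n) (simp_all add: rf_const_add)

lemma rf_const_minus: "rf_const (- x) = - rf_const x"
  using rf_const_add[of x "- x"] by (simp add: eq_neg_iff_add_eq_0 add.commute)

lemma rf_const_of_int: "rf_const (of_int n) = of_int n"
  by (cases n rule: int_cases2) (simp_all add: rf_const_of_nat rf_const_minus)

lemma rf_const_inverse: "rf_const (inverse x) = inverse (rf_const x)"
proof (cases "x = 0")
  case False
  then have "rf_const x * rf_const (inverse x) = 1" by (simp flip: rf_const_mult)
  then show ?thesis by (metis inverse_unique)
qed simp

lemma rf_const_power: "rf_const (x ^ n) = rf_const x ^ n"
  by (induction n) (simp_all add: rf_const_mult)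

lemma rf_var_nonzero: "rf_var j \<noteq> 0"
proof
  assume "rf_var j = 0"
  then have "Poly_Mapping.single (Poly_Mapping.single j (1::nat)) (1::complex) = 0"
    by (simp add: rf_var_def Zero_fract_def eq_fract)
  then have "Poly_Mapping.lookup (Poly_Mapping.single (Poly_Mapping.single j (1::nat)) (1::complex))
      (Poly_Mapping.single j 1) = 0" by simp
  then show False by simp
qed

definition wdeg :: "nat set \<Rightarrow> (nat \<Rightarrow> int) \<Rightarrow> (nat \<Rightarrow> int) \<Rightarrow> int" where
  "wdeg S w a = (\<Sum>j\<in>S. w j * a j)"

lemma wdeg_add: "wdeg S w (\<lambda>j. a j + b j) = wdeg S w a + wdeg S w b"
  and wdeg_diff: "wdeg S w (\<lambda>j. a j - b j) = wdeg S w a - wdeg S w b"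
  and wdeg_scale: "wdeg S w (\<lambda>j. c * a j) = c * wdeg S w a"
  by (simp_all add: wdeg_def distrib_left right_diff_distrib sum.distrib sum_subtractf
      sum_distrib_left mult_ac)

locale weighted =
  fixes S :: "nat set" and w :: "nat \<Rightarrow> int"
begin

text \<open>
  On the space of all series a nonzero polynomial may act with a kernel (the geometric series in
  both directions is annihilated by \<open>1 - x\<close>). Bounding the weight from below restores
  uniqueness. Cancellability is the form in which this is used, since it passes from two
  denominators to their product.
\<close>

definition bounded_series :: "series \<Rightarrow> bool" where
  "bounded_series f \<longleftrightarrow> (\<exists>K. \<forall>a. f a \<noteq> 0 \<longrightarrow> K \<le> wdeg S w a)"

definition cancellable :: "mpol \<Rightarrow> bool" where
  "cancellable q \<longleftrightarrow> (\<forall>f. bounded_series f \<longrightarrow> act q f = (\<lambda>_. 0) \<longrightarrow> f = (\<lambda>_. 0))"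

definition expands :: "ratfun \<Rightarrow> series \<Rightarrow> bool" where
  "expands \<phi> f \<longleftrightarrow> bounded_series f \<and>
    (\<exists>p q. q \<noteq> 0 \<and> \<phi> = Fract p q \<and> cancellable q \<and> act q f = act p one_series)"

lemma expandsI:
  "q \<noteq> 0 \<Longrightarrow> \<phi> = Fract p q \<Longrightarrow> cancellable q \<Longrightarrow> act q f = act p one_series \<Longrightarrow>
    bounded_series f \<Longrightarrow> expands \<phi> f"
  unfolding expands_def by blast

lemma expandsE:
  assumes "expands \<phi> f"
  obtains p q where "q \<noteq> 0" "\<phi> = Fract p q" "cancellable q" "act q f = act p one_series"
    "bounded_series f"
  using assms unfolding expands_def by blast

lemma bounded_series_shift:
  assumes "bounded_series f" "\<And>a. g a \<noteq> 0 \<Longrightarrow> f (\<lambda>j. a j - t j) \<noteq> 0"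
  shows "bounded_series g"
proof -
  obtain K where K: "\<And>a. f a \<noteq> 0 \<Longrightarrow> K \<le> wdeg S w a"
    using assms(1) by (auto simp: bounded_series_def)
  have "K + wdeg S w t \<le> wdeg S w a" if "g a \<noteq> 0" for a
    using K[OF assms(2)[OF that]] by (simp add: wdeg_diff)
  then show ?thesis by (auto simp: bounded_series_def)
qed

lemma bounded_series_mono: "bounded_series f \<Longrightarrow> (\<And>a. g a \<noteq> 0 \<Longrightarrow> f a \<noteq> 0) \<Longrightarrow> bounded_series g"
  using bounded_series_shift[of f g "\<lambda>_. 0"] by simp

lemma bounded_series_add:
  assumes "bounded_series f" "bounded_series g"
  shows "bounded_series (\<lambda>a. f a + g a)"
proof -
  obtain K L where K: "\<And>a. f a \<noteq> 0 \<Longrightarrow> K \<le> wdeg S w a" and L: "\<And>a. g a \<noteq> 0 \<Longrightarrow> L \<le> wdeg S w a"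
    using assms by (auto simp: bounded_series_def)
  have "min K L \<le> wdeg S w a" if "f a + g a \<noteq> 0" for a
  proof (cases "f a = 0")
    case True
    then show ?thesis using L[of a] that by auto
  qed (use K[of a] in auto)
  then show ?thesis by (auto simp: bounded_series_def)
qed

lemma bounded_series_zero: "bounded_series (\<lambda>_. 0)"
  by (simp add: bounded_series_def)

lemma bounded_series_scale: "bounded_series f \<Longrightarrow> bounded_series (\<lambda>a. c * f a)"
  by (erule bounded_series_mono) auto

lemma bounded_series_act: "bounded_series f \<Longrightarrow> bounded_series (act q f)"
proof (induction q rule: mpol_induct)
  case (add b c q)
  have "bounded_series (act (Poly_Mapping.single b c) f)"
    using add(2) by (rule bounded_series_shift[where t = "\<lambda>j. int (Poly_Mapping.lookup b j)"])
      (simp add: act_single)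
  with add show ?case by (simp add: act_add_left bounded_series_add)
qed (simp add: bounded_series_zero)

lemma bounded_series_one: "bounded_series one_series"
  by (auto simp: bounded_series_def one_series_def)

lemma bounded_series_deriv: "bounded_series f \<Longrightarrow> bounded_series (series_deriv j f)"
proof (erule bounded_series_shift[where t = "\<lambda>i. if i = j then - 1 else 0"])
  fix a :: "nat \<Rightarrow> int"
  have "(\<lambda>i. a i - (if i = j then - 1 else 0)) = a(j := a j + 1)" by (rule ext) simp
  then show "series_deriv j f a \<noteq> 0 \<Longrightarrow> f (\<lambda>i. a i - (if i = j then - 1 else 0)) \<noteq> 0"
    by (simp only:) (simp add: series_deriv_def)
qed

lemma cancellable_one: "cancellable 1"
proof -
  have "act 1 f = f" for f :: series
    using act_single[of 0 1 f] by (simp add: single_one)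
  then show ?thesis by (simp add: cancellable_def)
qed

lemma cancellable_mult: "cancellable p \<Longrightarrow> cancellable q \<Longrightarrow> cancellable (p * q)"
  unfolding cancellable_def act_mult using bounded_series_act by blast

lemma cancellable_var: "cancellable (Poly_Mapping.single b 1)"
  unfolding cancellable_def
proof (intro allI impI)
  fix f :: series
  assume "act (Poly_Mapping.single b 1) f = (\<lambda>_. 0)"
  then have z: "f (\<lambda>j. a j - int (Poly_Mapping.lookup b j)) = 0" for a
    by (simp add: act_single fun_eq_iff)
  show "f = (\<lambda>_. 0)"
  proof
    fix a show "f a = 0" using z[of "\<lambda>j. a j + int (Poly_Mapping.lookup b j)"] by simp
  qed
qed

text \<open>
  The product of the lowest monomial of \<open>q\<close> with a lowest monomial of \<open>f\<close>
  cannot cancel against anything else.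
\<close>

lemma cancellable_if_unique_minimum:
  assumes b0: "b0 \<in> Poly_Mapping.keys q"
    and min: "\<And>b. b \<in> Poly_Mapping.keys q \<Longrightarrow> b \<noteq> b0 \<Longrightarrow>
      wdeg S w (\<lambda>j. int (Poly_Mapping.lookup b0 j)) < wdeg S w (\<lambda>j. int (Poly_Mapping.lookup b j))"
  shows "cancellable q"
  unfolding cancellable_def
proof (intro allI impI)
  fix f
  assume bd: "bounded_series f" and z: "act q f = (\<lambda>_. 0)"
  obtain K where K: "\<And>a. f a \<noteq> 0 \<Longrightarrow> K \<le> wdeg S w a"
    using bd by (auto simp: bounded_series_def)
  show "f = (\<lambda>_. 0)"
  proof (rule ccontr)
    assume "f \<noteq> (\<lambda>_. 0)"
    then obtain a' where "f a' \<noteq> 0" by auto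
    then obtain a where a: "f a \<noteq> 0"
      and least: "\<And>a'. f a' \<noteq> 0 \<Longrightarrow> nat (wdeg S w a - K) \<le> nat (wdeg S w a' - K)"
      using ex_has_least_nat[of "\<lambda>a. f a \<noteq> 0" a' "\<lambda>a. nat (wdeg S w a - K)"] by blast
    have least': "wdeg S w a \<le> wdeg S w a'" if "f a' \<noteq> 0" for a'
      using least[OF that] K[OF that] K[OF a] by linarith
    let ?c = "\<lambda>j. a j + int (Poly_Mapping.lookup b0 j)"
    have "act q f ?c = (\<Sum>b\<in>Poly_Mapping.keys q. if b = b0 then Poly_Mapping.lookup q b0 * f a else 0)"
      unfolding act_def
    proof (rule sum.cong)
      fix b assume b: "b \<in> Poly_Mapping.keys q"
      show "Poly_Mapping.lookup q b * f (\<lambda>j. ?c j - int (Poly_Mapping.lookup b j)) =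
          (if b = b0 then Poly_Mapping.lookup q b0 * f a else 0)"
      proof (cases "b = b0")
        case False
        have "f (\<lambda>j. ?c j - int (Poly_Mapping.lookup b j)) = 0"
          using least'[of "\<lambda>j. ?c j - int (Poly_Mapping.lookup b j)"] min[OF b False]
          unfolding wdeg_diff wdeg_add by linarith
        with False show ?thesis by simp
      qed simp
    qed simp
    also have "\<dots> = Poly_Mapping.lookup q b0 * f a" using b0 by simp
    finally have "Poly_Mapping.lookup q b0 * f a = 0" using z by simp
    then show False using a b0 by (simp add: in_keys_iff)
  qed
qed

lemma expands_unique:
  assumes "expands \<phi> f" "expands \<phi> g"
  shows "f = g"
proof -
  obtain p q where f: "q \<noteq> 0" "\<phi> = Fract p q" "cancellable q" "act q f = act p one_series" "bounded_series f"
    using assms(1) by (rule expandsE)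
  obtain p' q' where g: "q' \<noteq> 0" "\<phi> = Fract p' q'" "cancellable q'" "act q' g = act p' one_series" "bounded_series g"
    using assms(2) by (rule expandsE)
  have eq: "p * q' = p' * q" using f g by (simp add: eq_fract)
  have "act (q * q') f = act (q * q') g"
  proof -
    have "act (q * q') f = act q' (act q f)" by (metis act_mult act_commute)
    also have "\<dots> = act (p * q') one_series" by (metis f(4) act_mult act_commute)
    also have "\<dots> = act q (act q' g)" unfolding eq by (metis g(4) act_mult act_commute)
    finally show ?thesis by (simp add: act_mult)
  qed
  moreover have "bounded_series (\<lambda>a. f a - g a)"
    using bounded_series_add[OF f(5) bounded_series_scale[OF g(5), of "- 1"]] by simp
  ultimately have "(\<lambda>a. f a - g a) = (\<lambda>_. 0)"
    using cancellable_mult[OF f(3) g(3)] by (simp add: cancellable_def act_diff)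
  then show ?thesis by (simp add: fun_eq_iff)
qed

text \<open>
  A rational function can be read off from its expansion, so identities of rational functions
  may be checked on coefficients.
\<close>

lemma expands_inj:
  assumes "expands \<phi> f" "expands \<psi> f"
  shows "\<phi> = \<psi>"
proof -
  obtain p q where f: "q \<noteq> 0" "\<phi> = Fract p q" "act q f = act p one_series"
    using assms(1) by (rule expandsE)
  obtain p' q' where g: "q' \<noteq> 0" "\<psi> = Fract p' q'" "act q' f = act p' one_series"
    using assms(2) by (rule expandsE)
  have "act (p * q') one_series = act (p' * q) one_series"
    by (metis f(3) g(3) act_mult act_commute)
  then have "p * q' - p' * q = 0"
    by (intro act_one_series_eq_0) (simp add: act_diff_left)
  then show ?thesis using f g by (simp add: eq_fract)
qed

lemma expands_add:
  assumes "expands \<phi> f" "expands \<psi> g"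
  shows "expands (\<phi> + \<psi>) (\<lambda>a. f a + g a)"
proof -
  obtain p q where f: "q \<noteq> 0" "\<phi> = Fract p q" "cancellable q" "act q f = act p one_series" "bounded_series f"
    using assms(1) by (rule expandsE)
  obtain p' q' where g: "q' \<noteq> 0" "\<psi> = Fract p' q'" "cancellable q'" "act q' g = act p' one_series" "bounded_series g"
    using assms(2) by (rule expandsE)
  have 1: "act (q * q') f = act (p * q') one_series"
    by (metis f(4) act_mult act_commute)
  have 2: "act (q * q') g = act (p' * q) one_series"
    by (metis g(4) act_mult act_commute)
  have "act (q * q') (\<lambda>a. f a + g a) = act (p * q' + p' * q) one_series"
    by (simp add: act_add 1 2 act_add_left)
  moreover have "\<phi> + \<psi> = Fract (p * q' + p' * q) (q * q')" using f g by simp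
  ultimately show ?thesis
    using f g by (intro expandsI[of "q * q'" _ "p * q' + p' * q"] cancellable_mult bounded_series_add) auto
qed

lemma expands_zero: "expands 0 (\<lambda>_. 0)"
  unfolding expands_def
  by (intro conjI bounded_series_zero exI[of _ 0] exI[of _ 1]) (simp_all add: cancellable_one Zero_fract_def)

lemma expands_one: "expands 1 one_series"
  unfolding expands_def
  by (intro conjI bounded_series_one exI[of _ 1]) (simp_all add: cancellable_one One_fract_def)

lemma expands_sum:
  assumes "\<And>i. i \<in> I \<Longrightarrow> expands (\<phi> i) (f i)"
  shows "expands (\<Sum>i\<in>I. \<phi> i) (\<lambda>a. \<Sum>i\<in>I. f i a)"
  using assms
  by (induction I rule: infinite_finite_induct) (simp_all add: expands_zero expands_add)

lemma expands_mult_poly: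
  assumes "expands \<phi> f"
  shows "expands (Fract r 1 * \<phi>) (act r f)"
proof -
  obtain p q where f: "q \<noteq> 0" "\<phi> = Fract p q" "cancellable q" "act q f = act p one_series" "bounded_series f"
    using assms(1) by (rule expandsE)
  have "act q (act r f) = act (r * p) one_series"
    by (metis f(4) act_mult act_commute)
  moreover have "Fract r 1 * \<phi> = Fract (r * p) q" using f by simp
  ultimately show ?thesis
    using f by (intro expandsI bounded_series_act) auto
qed

lemma expands_const_mult: "expands \<phi> f \<Longrightarrow> expands (rf_const c * \<phi>) (\<lambda>a. c * f a)"
  unfolding rf_const_def using expands_mult_poly[of \<phi> f "Poly_Mapping.single 0 c"] by (simp add: act_single)

lemma expands_var_mult: "expands \<phi> f \<Longrightarrow> expands (rf_var j * \<phi>) (\<lambda>a. f (a(j := a j - 1)))"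
proof -
  assume "expands \<phi> f"
  moreover have "(\<lambda>i. a i - int (Poly_Mapping.lookup (Poly_Mapping.single j 1) i)) = a(j := a j - 1)" for a
    by (auto simp: lookup_single when_def)
  ultimately show ?thesis
    unfolding rf_var_def using expands_mult_poly[of \<phi> f "Poly_Mapping.single (Poly_Mapping.single j 1) 1"]
    by (simp add: act_single)
qed

lemma expands_var_divide:
  assumes "expands \<phi> f"
  shows "expands (\<phi> / rf_var j) (\<lambda>a. f (a(j := a j + 1)))"
proof -
  let ?x = "Poly_Mapping.single (Poly_Mapping.single j (1::nat)) (1::complex)"
  obtain p q where f: "q \<noteq> 0" "\<phi> = Fract p q" "cancellable q" "act q f = act p one_series" "bounded_series f"
    using assms(1) by (rule expandsE)
  have x: "?x \<noteq> 0" using rf_var_nonzero[of j] by (auto simp: rf_var_def Zero_fract_def)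
  have e: "(\<lambda>i. a i - int (Poly_Mapping.lookup (Poly_Mapping.single j 1) i)) = a(j := a j - 1)" for a
    by (auto simp: lookup_single when_def)
  have "act ?x (\<lambda>a. f (a(j := a j + 1))) = f"
    unfolding act_single e by simp
  then have "act (q * ?x) (\<lambda>a. f (a(j := a j + 1))) = act q f"
    by (simp only: act_mult)
  then have 1: "act (q * ?x) (\<lambda>a. f (a(j := a j + 1))) = act p one_series" using f by simp
  have 2: "\<phi> / rf_var j = Fract p (q * ?x)" using f x by (simp add: rf_var_def)
  have 3: "bounded_series (\<lambda>a. f (a(j := a j + 1)))"
    using f(5)
  proof (rule bounded_series_shift[where t = "\<lambda>i. if i = j then - 1 else 0"])
    fix a :: "nat \<Rightarrow> int"
    have "(\<lambda>i. a i - (if i = j then - 1 else 0)) = a(j := a j + 1)" by (rule ext) simp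
    then show "f (a(j := a j + 1)) \<noteq> 0 \<Longrightarrow> f (\<lambda>i. a i - (if i = j then - 1 else 0)) \<noteq> 0"
      by simp
  qed
  show ?thesis
    by (rule expandsI[OF _ 2 cancellable_mult[OF f(3) cancellable_var] 1 3]) (use f(1) x in simp)
qed

lemma expands_var_powi:
  assumes "expands \<phi> f"
  shows "expands (\<phi> * rf_var j powi n) (\<lambda>a. f (a(j := a j - n)))"
proof (cases n rule: int_cases2)
  case (nonneg k)
  have "expands (\<phi> * rf_var j ^ k) (\<lambda>a. f (a(j := a j - int k)))"
  proof (induction k)
    case (Suc k)
    have "(a(j := a j - 1))(j := (a(j := a j - 1)) j - int k) = a(j := a j - int (Suc k))" for a
      by (rule ext) simp
    then show ?case
      using expands_var_mult[OF Suc, of j] by (simp add: mult_ac del: fun_upd_apply fun_upd_upd)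
  qed (use assms in simp)
  then show ?thesis by (simp add: nonneg)
next
  case (nonpos k)
  have "expands (\<phi> / rf_var j ^ k) (\<lambda>a. f (a(j := a j + int k)))"
  proof (induction k)
    case (Suc k)
    have "(a(j := a j + 1))(j := (a(j := a j + 1)) j + int k) = a(j := a j + int (Suc k))" for a
      by (rule ext) simp
    then show ?case
      using expands_var_divide[OF Suc, of j] by (simp add: mult_ac del: fun_upd_apply fun_upd_upd)
  qed (use assms in simp)
  then show ?thesis by (simp add: nonpos power_int_minus divide_inverse)
qed

lemma expands_deriv:
  assumes "expands \<phi> f"
  shows "expands (rf_deriv j \<phi>) (series_deriv j f)"
proof -
  obtain p q where f: "q \<noteq> 0" "\<phi> = Fract p q" "cancellable q" "act q f = act p one_series" "bounded_series f"
    using assms(1) by (rule expandsE)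
  have "series_deriv j (act q f) = series_deriv j (act p one_series)" using f by simp
  then have "act q (series_deriv j f) = (\<lambda>a. act (mp_deriv j p) one_series a - act (mp_deriv j q) f a)"
    unfolding series_deriv_act series_deriv_one_series by (simp add: fun_eq_iff eq_diff_eq add.commute)
  then have "act (q * q) (series_deriv j f) =
      (\<lambda>a. act q (act (mp_deriv j p) one_series) a - act q (act (mp_deriv j q) f) a)"
    by (simp add: act_mult act_diff)
  also have "act q (act (mp_deriv j q) f) = act (p * mp_deriv j q) one_series"
    by (metis f(4) act_mult act_commute)
  also have "act q (act (mp_deriv j p) one_series) = act (mp_deriv j p * q) one_series"
    by (metis act_mult act_commute)
  finally have "act (q * q) (series_deriv j f) = act (mp_deriv j p * q - p * mp_deriv j q) one_series"
    by (simp add: act_diff_left)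
  then show ?thesis
    by (intro expandsI[of "q * q" _ "mp_deriv j p * q - p * mp_deriv j q"])
      (use f in \<open>simp_all add: rf_deriv_Fract cancellable_mult bounded_series_deriv\<close>)
qed

text \<open>
  The equation \<open>q f = p\<close> is solved by recursion on the weight: the coefficient of \<open>q f\<close>
  at \<open>a + b0\<close> involves \<open>f a\<close> and coefficients of \<open>f\<close> of smaller weight.
\<close>

lemma expansion_exists:
  assumes b0: "b0 \<in> Poly_Mapping.keys q"
    and min: "\<And>b. b \<in> Poly_Mapping.keys q \<Longrightarrow> b \<noteq> b0 \<Longrightarrow>
      wdeg S w (\<lambda>j. int (Poly_Mapping.lookup b0 j)) < wdeg S w (\<lambda>j. int (Poly_Mapping.lookup b j))"
    and vars: "mvars p \<subseteq> S" "mvars q \<subseteq> S"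
  shows "\<exists>f. bounded_series f \<and> (\<forall>a j. f a \<noteq> 0 \<longrightarrow> j \<notin> S \<longrightarrow> a j = 0) \<and> act q f = act p one_series"
proof -
  define e :: "(nat \<Rightarrow>\<^sub>0 nat) \<Rightarrow> nat \<Rightarrow> int" where "e b j = int (Poly_Mapping.lookup b j)" for b j
  define X where "X = {a :: nat \<Rightarrow> int. \<forall>j. j \<notin> S \<longrightarrow> a j = 0}"
  define P where "P = act p one_series"
  have eX: "e b \<in> X" if "b \<in> Poly_Mapping.keys p \<union> Poly_Mapping.keys q" for b
  proof -
    have "Poly_Mapping.lookup b j = 0" if "j \<notin> S" for j
    proof (rule ccontr)
      assume "Poly_Mapping.lookup b j \<noteq> 0"
      then have "j \<in> Poly_Mapping.keys b" by (simp add: in_keys_iff)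
      then have "j \<in> mvars p \<union> mvars q"
        using \<open>b \<in> _\<close> by (auto simp: mvars_def)
      then show False using vars \<open>j \<notin> S\<close> by auto
    qed
    then show ?thesis by (simp add: X_def e_def)
  qed
  have b0S: "e b0 \<in> X" using eX b0 by simp
  obtain K' where K': "\<And>a. P a \<noteq> 0 \<Longrightarrow> K' \<le> wdeg S w a"
    using bounded_series_act[OF bounded_series_one] unfolding bounded_series_def P_def by blast
  \<comment> \<open>Below the weight \<open>K\<close> the right-hand side vanishes, so the recursion may start
    there with zero coefficients.\<close>
  define K where "K = K' - wdeg S w (e b0)"
  define step where "step g a = (if wdeg S w a < K \<or> a \<notin> X then 0 else
    (P (\<lambda>j. a j + e b0 j) - (\<Sum>b\<in>Poly_Mapping.keys q - {b0}.
      Poly_Mapping.lookup q b * g (\<lambda>j. a j + e b0 j - e b j))) / Poly_Mapping.lookup q b0)"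
    for g :: series and a
  define f where "f = wfrec (measure (\<lambda>a. nat (wdeg S w a - K + 1))) step"
  have less: "wdeg S w (\<lambda>j. a j + e b0 j - e b j) < wdeg S w a"
    if "b \<in> Poly_Mapping.keys q - {b0}" for a b
    using min[of b] that unfolding wdeg_diff wdeg_add by (simp add: e_def)
  have f: "f a = step f a" for a
  proof -
    have "f a = step (cut f (measure (\<lambda>a. nat (wdeg S w a - K + 1))) a) a"
      unfolding f_def by (rule wfrec) simp
    also have "\<dots> = step f a"
    proof (cases "wdeg S w a < K \<or> a \<notin> X")
      case False
      have "cut f (measure (\<lambda>a. nat (wdeg S w a - K + 1))) a (\<lambda>j. a j + e b0 j - e b j) =
          f (\<lambda>j. a j + e b0 j - e b j)" if "b \<in> Poly_Mapping.keys q - {b0}" for b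
        using less[OF that, of a] False by (intro cut_apply) auto
      then show ?thesis unfolding step_def by simp
    qed (simp add: step_def)
    finally show ?thesis .
  qed
  have supp: "a \<in> X" "K \<le> wdeg S w a" if "f a \<noteq> 0" for a
    using f[of a] that by (auto simp: step_def split: if_splits)
  have "act q f c = P c" for c
  proof -
    define a where "a = (\<lambda>j. c j - e b0 j)"
    have c: "c = (\<lambda>j. a j + e b0 j)" by (simp add: a_def)
    have "act q f c = Poly_Mapping.lookup q b0 * f (\<lambda>j. c j - e b0 j) +
        (\<Sum>b\<in>Poly_Mapping.keys q - {b0}. Poly_Mapping.lookup q b * f (\<lambda>j. c j - e b j))"
      unfolding act_def e_def by (rule sum.remove) (use b0 in auto)
    also have "\<dots> = Poly_Mapping.lookup q b0 * f a +
        (\<Sum>b\<in>Poly_Mapping.keys q - {b0}. Poly_Mapping.lookup q b * f (\<lambda>j. a j + e b0 j - e b j))"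
      by (simp add: c)
    also have "\<dots> = P c"
    proof (cases "wdeg S w a < K \<or> a \<notin> X")
      case False
      then show ?thesis using b0 by (subst f) (simp add: step_def c in_keys_iff)
    next
      case True
      have "f a = 0" using True by (subst f) (simp add: step_def)
      moreover have "f (\<lambda>j. a j + e b0 j - e b j) = 0" if b: "b \<in> Poly_Mapping.keys q - {b0}" for b
      proof (rule ccontr)
        assume nz: "f (\<lambda>j. a j + e b0 j - e b j) \<noteq> 0"
        have "(\<lambda>j. a j + e b0 j - e b j) \<in> X" using supp(1)[OF nz] .
        then have "a \<in> X" using b0S eX[of b] b unfolding X_def by auto
        moreover have "K \<le> wdeg S w a" using supp(2)[OF nz] less[OF b, of a] by simp
        ultimately show False using True by simp
      qed
      moreover have "P c = 0"
      proof (rule ccontr)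
        assume nz: "P c \<noteq> 0"
        then obtain b where "b \<in> Poly_Mapping.keys p" "c = e b"
          unfolding P_def e_def by (rule act_one_series_nonzeroE) auto
        then have "c \<in> X" using eX by auto
        then have "a \<in> X" using b0S by (auto simp: a_def X_def)
        moreover have "K \<le> wdeg S w a" using K'[OF nz] by (simp add: K_def a_def wdeg_diff)
        ultimately show False using True by simp
      qed
      ultimately show ?thesis by simp
    qed
    finally show ?thesis .
  qed
  then have "act q f = act p one_series" by (simp add: P_def fun_eq_iff)
  moreover have "bounded_series f" using supp(2) by (auto simp: bounded_series_def)
  ultimately show ?thesis using supp(1) by (auto simp: X_def intro!: exI[of _ f])
qed

end

section \<open>The hypergeometric system on coefficients\<close>

text \<open>
  The system on the level of coefficients. The Euler operators confine the support to
  the fibre of \<open>\<alpha>\<close>. The operator equation belonging to \<open>a - b\<close> compares the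
  coefficients at \<open>a\<close> and \<open>b\<close> after both have been lowered to the componentwise
  minimum of \<open>a\<close> and \<open>b\<close>; each derivative contributes one factor \<open>i\<close>.
\<close>

definition hypergeometric_series :: "nat set \<Rightarrow> int \<times> int \<Rightarrow> series \<Rightarrow> bool" where
  "hypergeometric_series S \<alpha> f \<longleftrightarrow>
    (\<forall>a. f a \<noteq> 0 \<longrightarrow> (\<forall>j. j \<notin> S \<longrightarrow> a j = 0) \<and> mat_vec S a = \<alpha>) \<and>
    (\<forall>a b. mat_vec S a = mat_vec S b \<longrightarrow> (\<forall>j. j \<notin> S \<longrightarrow> a j = b j) \<longrightarrow>
      f a * (\<Prod>j\<in>S. \<Prod>i\<in>{b j<..a j}. of_int i) = f b * (\<Prod>j\<in>S. \<Prod>i\<in>{a j<..b j}. of_int i))"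

context weighted
begin

lemma expands_deriv_power:
  assumes "expands \<phi> f"
  shows "expands ((rf_deriv j ^^ n) \<phi>)
    (\<lambda>a. (\<Prod>i\<in>{a j<..a j + int n}. of_int i) * f (a(j := a j + int n)))"
proof (induction n)
  case (Suc n)
  have "series_deriv j (\<lambda>a. (\<Prod>i\<in>{a j<..a j + int n}. of_int i) * f (a(j := a j + int n))) a =
      (\<Prod>i\<in>{a j<..a j + int (Suc n)}. of_int i) * f (a(j := a j + int (Suc n)))" for a
  proof -
    have "{a j<..a j + int (Suc n)} = insert (a j + 1) {a j + 1<..a j + 1 + int n}" by auto
    then show ?thesis by (simp add: series_deriv_def add_ac)
  qed
  then have eq: "series_deriv j (\<lambda>a. (\<Prod>i\<in>{a j<..a j + int n}. of_int i) * f (a(j := a j + int n))) =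
      (\<lambda>a. (\<Prod>i\<in>{a j<..a j + int (Suc n)}. of_int i) * f (a(j := a j + int (Suc n))))"
    by (rule ext)
  show ?case using expands_deriv[OF Suc, of j] unfolding eq by (simp only: funpow.simps o_apply)
qed (use assms in simp)

lemma expands_diff_op:
  assumes "finite T" "expands \<phi> f"
  shows "expands (diff_op T u \<phi>)
    (\<lambda>a. (\<Prod>j\<in>T. \<Prod>i\<in>{a j<..a j + int (u j)}. of_int i) *
      f (\<lambda>j. if j \<in> T then a j + int (u j) else a j))"
proof -
  have "expands (foldr (\<lambda>j. rf_deriv j ^^ u j) xs \<phi>)
    (\<lambda>a. (\<Prod>j\<in>set xs. \<Prod>i\<in>{a j<..a j + int (u j)}. of_int i) *
      f (\<lambda>j. if j \<in> set xs then a j + int (u j) else a j))" if "distinct xs" for xs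
    using that
  proof (induction xs)
    case (Cons x xs)
    let ?g = "\<lambda>xs a. (\<Prod>j\<in>set xs. \<Prod>i\<in>{a j<..a j + int (u j)}. of_int i) *
      f (\<lambda>j. if j \<in> set xs then a j + int (u j) else a j)"
    have "(\<Prod>i\<in>{a x<..a x + int (u x)}. of_int i) * ?g xs (a(x := a x + int (u x))) = ?g (x # xs) a" for a
    proof -
      have x: "x \<notin> set xs" using Cons.prems by simp
      have 1: "(\<lambda>j. if j \<in> set xs then (a(x := a x + int (u x))) j + int (u j) else (a(x := a x + int (u x))) j) =
          (\<lambda>j. if j \<in> set (x # xs) then a j + int (u j) else a j)"
        using x by auto
      have "(\<Prod>j\<in>set xs. \<Prod>i\<in>{(a(x := a x + int (u x))) j<..(a(x := a x + int (u x))) j + int (u j)}. of_int i) =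
          (\<Prod>j\<in>set xs. \<Prod>i\<in>{a j<..a j + int (u j)}. of_int i :: complex)"
        using x by (intro prod.cong refl) auto
      then show ?thesis unfolding 1 using x by (simp add: mult.assoc)
    qed
    then have eq: "(\<lambda>a. (\<Prod>i\<in>{a x<..a x + int (u x)}. of_int i) * ?g xs (a(x := a x + int (u x)))) = ?g (x # xs)"
      by (rule ext)
    have "expands (foldr (\<lambda>j. rf_deriv j ^^ u j) xs \<phi>) (?g xs)"
      using Cons by simp
    from expands_deriv_power[OF this, of "u x" x] show ?case
      unfolding eq by (simp only: foldr.simps o_apply)
  qed (use assms in simp)
  from this[of "sorted_list_of_set T"] show ?thesis
    using assms(1) by (simp add: diff_op_def)
qed

lemma hypergeometric_series_expansion:
  assumes S: "finite S" and sol: "hypergeometric_solution S \<alpha> \<phi>" and f: "expands \<phi> f"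
    and supp: "\<And>a j. f a \<noteq> 0 \<Longrightarrow> j \<notin> S \<Longrightarrow> a j = 0"
  shows "hypergeometric_series S \<alpha> f"
proof -
  have euler: "expands (rf_var j * rf_deriv j \<phi>) (\<lambda>a. of_int (a j) * f a)" for j
    using expands_var_mult[OF expands_deriv[OF f], of j j]
    by (simp add: series_deriv_def)
  have "expands (of_int (fst \<alpha>) * \<phi>) (\<lambda>a. \<Sum>j\<in>S. of_int (a j) * f a)"
    using expands_sum[of S "\<lambda>j. rf_var j * rf_deriv j \<phi>", OF euler] sol
    by (simp add: hypergeometric_solution_def)
  moreover have "expands (of_int (fst \<alpha>) * \<phi>) (\<lambda>a. of_int (fst \<alpha>) * f a)"
    using expands_const_mult[OF f, of "of_int (fst \<alpha>)"] by (simp add: rf_const_of_int)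
  ultimately have e1: "(\<lambda>a. \<Sum>j\<in>S. of_int (a j) * f a) = (\<lambda>a. of_int (fst \<alpha>) * f a)"
    by (rule expands_unique)
  have "expands (of_nat j * rf_var j * rf_deriv j \<phi>) (\<lambda>a. of_nat j * (of_int (a j) * f a))" for j
    using expands_const_mult[OF euler[of j], of "of_nat j"] by (simp add: rf_const_of_nat mult_ac)
  then have "expands (of_int (snd \<alpha>) * \<phi>) (\<lambda>a. \<Sum>j\<in>S. of_nat j * (of_int (a j) * f a))"
    using expands_sum[of S "\<lambda>j. of_nat j * rf_var j * rf_deriv j \<phi>"] sol
    by (simp add: hypergeometric_solution_def)
  moreover have "expands (of_int (snd \<alpha>) * \<phi>) (\<lambda>a. of_int (snd \<alpha>) * f a)"
    using expands_const_mult[OF f, of "of_int (snd \<alpha>)"] by (simp add: rf_const_of_int)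
  ultimately have e2: "(\<lambda>a. \<Sum>j\<in>S. of_nat j * (of_int (a j) * f a)) = (\<lambda>a. of_int (snd \<alpha>) * f a)"
    by (rule expands_unique)
  have level: "mat_vec S a = \<alpha>" if "f a \<noteq> 0" for a
  proof -
    have "of_int (\<Sum>j\<in>S. a j) * f a = of_int (fst \<alpha>) * f a"
      using fun_cong[OF e1, of a] by (simp add: sum_distrib_right)
    then have 1: "(\<Sum>j\<in>S. a j) = fst \<alpha>" using that by (simp only: mult_cancel_right of_int_eq_iff) simp
    have "of_int (\<Sum>j\<in>S. int j * a j) * f a = of_int (snd \<alpha>) * f a"
      using fun_cong[OF e2, of a]
      by (simp only: of_int_sum of_int_mult of_int_of_nat_eq sum_distrib_right mult.assoc)
    then have 2: "(\<Sum>j\<in>S. int j * a j) = snd \<alpha>" using that by (simp only: mult_cancel_right of_int_eq_iff) simp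
    show ?thesis using 1 2 by (simp add: mat_vec_def)
  qed
  have box: "f a * (\<Prod>j\<in>S. \<Prod>i\<in>{b j<..a j}. of_int i) = f b * (\<Prod>j\<in>S. \<Prod>i\<in>{a j<..b j}. of_int i)"
    if "mat_vec S a = mat_vec S b" and out: "\<And>j. j \<notin> S \<Longrightarrow> a j = b j" for a b
  proof -
    define v where "v j = a j - b j" for j
    define c where "c j = min (a j) (b j)" for j
    have "mat_vec S v = (0, 0)"
      using that(1) by (simp add: mat_vec_def v_def sum_subtractf right_diff_distrib)
    then have eq: "diff_op {j \<in> S. v j > 0} (\<lambda>j. nat (v j)) \<phi> = diff_op {j \<in> S. v j < 0} (\<lambda>j. nat (- v j)) \<phi>"
      using sol by (simp add: hypergeometric_solution_def)
    have fin: "finite {j \<in> S. v j > 0}" "finite {j \<in> S. v j < 0}" using S by auto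
    have "(\<Prod>j\<in>{j \<in> S. v j > 0}. \<Prod>i\<in>{c j<..c j + int (nat (v j))}. of_int i) *
        f (\<lambda>j. if j \<in> {j \<in> S. v j > 0} then c j + int (nat (v j)) else c j) =
      (\<Prod>j\<in>{j \<in> S. v j < 0}. \<Prod>i\<in>{c j<..c j + int (nat (- v j))}. of_int i) *
        f (\<lambda>j. if j \<in> {j \<in> S. v j < 0} then c j + int (nat (- v j)) else c j)"
      using expands_unique[OF expands_diff_op[OF fin(1) f, of "\<lambda>j. nat (v j)", unfolded eq]
        expands_diff_op[OF fin(2) f, of "\<lambda>j. nat (- v j)"]] by (rule fun_cong)
    also have "(\<lambda>j. if j \<in> {j \<in> S. v j > 0} then c j + int (nat (v j)) else c j) = a"
      using out by (force simp: v_def c_def)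
    also have "(\<lambda>j. if j \<in> {j \<in> S. v j < 0} then c j + int (nat (- v j)) else c j) = b"
      using out by (force simp: v_def c_def)
    also have "(\<Prod>j\<in>{j \<in> S. v j > 0}. \<Prod>i\<in>{c j<..c j + int (nat (v j))}. of_int i) =
        (\<Prod>j\<in>S. \<Prod>i\<in>{b j<..a j}. of_int i :: complex)"
      by (rule prod.mono_neutral_cong_left) (use S in \<open>auto simp: v_def c_def min_def intro!: prod.neutral\<close>)
    also have "(\<Prod>j\<in>{j \<in> S. v j < 0}. \<Prod>i\<in>{c j<..c j + int (nat (- v j))}. of_int i) =
        (\<Prod>j\<in>S. \<Prod>i\<in>{a j<..b j}. of_int i :: complex)"
      by (rule prod.mono_neutral_cong_left) (use S in \<open>auto simp: v_def c_def min_def intro!: prod.neutral\<close>)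
    finally show ?thesis by (simp add: mult.commute)
  qed
  show ?thesis unfolding hypergeometric_series_def using supp level box by blast
qed

end

lemma hypergeometric_seriesD:
  assumes "hypergeometric_series S \<alpha> f"
  shows hypergeometric_series_outside: "f a \<noteq> 0 \<Longrightarrow> j \<notin> S \<Longrightarrow> a j = 0"
    and hypergeometric_series_level: "f a \<noteq> 0 \<Longrightarrow> mat_vec S a = \<alpha>"
    and hypergeometric_series_box: "mat_vec S a = mat_vec S b \<Longrightarrow> (\<And>j. j \<notin> S \<Longrightarrow> a j = b j) \<Longrightarrow>
      f a * (\<Prod>j\<in>S. \<Prod>i\<in>{b j<..a j}. of_int i) = f b * (\<Prod>j\<in>S. \<Prod>i\<in>{a j<..b j}. of_int i)"
  using assms unfolding hypergeometric_series_def by blast+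

text \<open>
  The factor belonging to a coordinate vanishes exactly when one passes from a nonnegative to a
  negative value. So nonzero coefficients spread to all exponents of the fibre with no new negative
  coordinates, and a coefficient vanishes if some exponent of the fibre has a strictly smaller set
  of negative coordinates.
\<close>

lemma
  assumes H: "hypergeometric_series S \<alpha> f" and "finite S" and a: "f a \<noteq> 0"
    and "mat_vec S a = mat_vec S b" "\<And>j. j \<notin> S \<Longrightarrow> b j = 0"
    and neg: "\<And>j. j \<in> S \<Longrightarrow> b j < 0 \<Longrightarrow> a j < 0"
  shows hypergeometric_series_support: "f b \<noteq> 0"
    and hypergeometric_series_neg_support: "\<And>j. j \<in> S \<Longrightarrow> a j < 0 \<Longrightarrow> b j < 0"
proof -
  have "f a * (\<Prod>j\<in>S. \<Prod>i\<in>{b j<..a j}. of_int i) = f b * (\<Prod>j\<in>S. \<Prod>i\<in>{a j<..b j}. of_int i)"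
    using assms(4,5) hypergeometric_series_outside[OF H a] by (intro hypergeometric_series_box[OF H]) auto
  moreover have "(\<Prod>j\<in>S. \<Prod>i\<in>{b j<..a j}. of_int i :: complex) \<noteq> 0"
    using assms(2) neg by (auto simp: prod_zero_iff) force
  ultimately have *: "f b * (\<Prod>j\<in>S. \<Prod>i\<in>{a j<..b j}. of_int i) \<noteq> 0" using a by auto
  then show "f b \<noteq> 0" by auto
  show "b j < 0" if j: "j \<in> S" "a j < 0" for j
  proof (rule ccontr)
    assume "\<not> b j < 0"
    then have "0 \<in> {a j<..b j}" using j by simp
    then have "(\<Prod>i\<in>{a j<..b j}. of_int i :: complex) = 0" by (intro prod_zero) auto
    then have "(\<Prod>j\<in>S. \<Prod>i\<in>{a j<..b j}. of_int i :: complex) = 0"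
      using j(1) assms(2) by (intro prod_zero) auto
    with * show False by simp
  qed
qed

section \<open>The support of a rational solution\<close>

text \<open>
  The relation \<open>d (1, k) = (d - k) (1, 0) + k (1, d)\<close> between three columns,
  as a vector in the kernel of the matrix.
\<close>

definition dir :: "nat \<Rightarrow> nat \<Rightarrow> nat \<Rightarrow> int" where
  "dir d k i = (if i = k then int d else 0) - (if i = 0 then int d - int k else 0) - (if i = d then int k else 0)"

locale curve =
  fixes S :: "nat set" and d :: nat
  assumes finite: "finite S" and zero_in: "0 \<in> S" and d_in: "d \<in> S"
    and le_d: "j \<in> S \<Longrightarrow> j \<le> d" and d_pos: "d > 0"
begin

lemma sum_dir:
  assumes "k \<in> S"
  shows "(\<Sum>i\<in>S. g i * dir d k i) = int d * g k - (int d - int k) * g 0 - int k * g d"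
proof -
  have "(\<Sum>i\<in>S. g i * dir d k i) = (\<Sum>i\<in>S. if i = k then g i * int d else 0) -
      (\<Sum>i\<in>S. if i = 0 then g i * (int d - int k) else 0) - (\<Sum>i\<in>S. if i = d then g i * int k else 0)"
    unfolding dir_def sum_subtractf[symmetric] by (intro sum.cong refl) (simp add: algebra_simps)
  then show ?thesis using assms finite zero_in d_in by (simp add: mult.commute)
qed

lemma mat_vec_dir:
  assumes "k \<in> S"
  shows "mat_vec S (\<lambda>i. a i + n * dir d k i) = mat_vec S a"
proof -
  have "(\<Sum>i\<in>S. n * dir d k i) = 0"
    using sum_dir[OF assms, of "\<lambda>_. n"] by (simp add: algebra_simps)
  moreover have "(\<Sum>i\<in>S. int i * (n * dir d k i)) = 0"
    using sum_dir[OF assms, of "\<lambda>i. int i * n"] by (simp add: algebra_simps)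
  ultimately show ?thesis by (simp add: mat_vec_def sum.distrib distrib_left)
qed

text \<open>
  If \<open>a k\<close> were negative, then subtracting multiples of \<open>dir d k\<close> would produce no
  new negative coordinate, so nonzero coefficients of arbitrarily small weight would exist.
\<close>

lemma interior_nonneg:
  assumes H: "hypergeometric_series S \<alpha> f" and bd: "weighted.bounded_series S w f"
    and w: "(int d - int k) * w 0 + int k * w d < int d * w k"
    and a: "f a \<noteq> 0" and k: "k \<in> S" "0 < k" "k < d"
  shows "a k \<ge> 0"
proof (rule ccontr)
  assume neg: "\<not> a k \<ge> 0"
  obtain K where K: "\<And>a. f a \<noteq> 0 \<Longrightarrow> K \<le> wdeg S w a"
    using bd by (auto simp: weighted.bounded_series_def)
  have D: "wdeg S w (dir d k) > 0"
    using sum_dir[OF k(1), of w] w by (simp add: wdeg_def)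
  define n where "n = max 0 (wdeg S w a - K + 1)"
  define b where "b = (\<lambda>i. a i + (- n) * dir d k i)"
  have n: "n \<ge> 0" by (simp add: n_def)
  have "f b \<noteq> 0"
    using H finite a
  proof (rule hypergeometric_series_support)
    show "mat_vec S a = mat_vec S b" unfolding b_def by (rule mat_vec_dir[OF k(1), symmetric])
    show "b j = 0" if "j \<notin> S" for j
    proof -
      have "a j = 0" using H a that by (auto simp: hypergeometric_series_def)
      moreover have "j \<noteq> 0" "j \<noteq> d" "j \<noteq> k" using that zero_in d_in k(1) by metis+
      ultimately show ?thesis by (simp add: b_def dir_def)
    qed
    show "a j < 0" if "b j < 0" for j
    proof (cases "j = k")
      case False
      then have "dir d k j \<le> 0" using k by (auto simp: dir_def)
      then have "(- n) * dir d k j \<ge> 0" using n by (simp add: mult_nonneg_nonpos)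
      then show ?thesis using that by (simp add: b_def)
    qed (use neg in simp)
  qed
  then have "K \<le> wdeg S w b" by (rule K)
  also have "wdeg S w b = wdeg S w a - n * wdeg S w (dir d k)"
    unfolding b_def wdeg_add wdeg_scale by simp
  also have "\<dots> \<le> wdeg S w a - n * 1"
    using D n by (intro diff_left_mono mult_left_mono) auto
  finally show False by (simp add: n_def)
qed

text \<open>
  If \<open>a 0 \<ge> 0\<close>, then \<open>\<Sum>j. (d - j) * a j\<close> is a constant on the fibre and has
  nonnegative terms, which bounds all coordinates except \<open>a d\<close>; the latter is then
  bounded by the equation \<open>\<Sum>j. a j = fst \<alpha>\<close>. The case \<open>a d \<ge> 0\<close> is
  symmetric, with \<open>\<Sum>j. j * a j\<close>.
\<close>

lemma level_bounds:
  shows "\<exists>B. \<forall>a. mat_vec S a = \<alpha> \<longrightarrow> (\<forall>j\<in>S. 0 < j \<longrightarrow> j < d \<longrightarrow> a j \<ge> 0) \<longrightarrow>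
    (a 0 \<ge> 0 \<or> a d \<ge> 0) \<longrightarrow> (\<forall>j\<in>S. \<bar>a j\<bar> \<le> B)"
proof -
  define B0 where "B0 = \<bar>int d * fst \<alpha> - snd \<alpha>\<bar> + \<bar>snd \<alpha>\<bar>"
  define B where "B = \<bar>fst \<alpha>\<bar> + int (card S) * B0 + B0"
  have B0: "B0 \<ge> 0" by (simp add: B0_def)
  \<comment> \<open>The coordinate \<open>z\<close> is the end point whose exponent may be negative.\<close>
  have *: "\<bar>a j\<bar> \<le> B" if z: "z \<in> S" and le: "\<And>i. i \<in> S \<Longrightarrow> i \<noteq> z \<Longrightarrow> 0 \<le> a i \<and> a i \<le> B0"
    and sum: "(\<Sum>i\<in>S. a i) = fst \<alpha>" and j: "j \<in> S" for a z j
  proof (cases "j = z")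
    case True
    have s: "(\<Sum>i\<in>S. a i) = a z + (\<Sum>i\<in>S - {z}. a i)" using z finite by (rule sum.remove[rotated])
    have "(\<Sum>i\<in>S - {z}. a i) \<le> (\<Sum>i\<in>S - {z}. B0)" using le by (intro sum_mono) auto
    also have "\<dots> \<le> int (card S) * B0"
      using B0 finite by (auto intro!: mult_right_mono card_mono)
    finally have 1: "(\<Sum>i\<in>S - {z}. a i) \<le> int (card S) * B0" .
    have 2: "0 \<le> (\<Sum>i\<in>S - {z}. a i)" using le by (intro sum_nonneg) auto
    show ?thesis using 1 2 s sum B0 unfolding B_def True by linarith
  next
    case False
    have "0 \<le> int (card S) * B0" using B0 by simp
    then show ?thesis using le[OF j False] unfolding B_def by linarith
  qed
  have "\<bar>a j\<bar> \<le> B" if lev: "mat_vec S a = \<alpha>" and int: "\<forall>j\<in>S. 0 < j \<longrightarrow> j < d \<longrightarrow> a j \<ge> 0"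
    and or: "a 0 \<ge> 0 \<or> a d \<ge> 0" and j: "j \<in> S" for a j
  proof -
    have s1: "(\<Sum>i\<in>S. a i) = fst \<alpha>" and s2: "(\<Sum>i\<in>S. int i * a i) = snd \<alpha>"
      using lev by (auto simp: mat_vec_def)
    show ?thesis
    proof (cases "a 0 \<ge> 0")
      case True
      have nn: "0 \<le> a i" if "i \<in> S" "i \<noteq> d" for i
        using True int that le_d[OF that(1)] by (cases "i = 0") auto
      have "(\<Sum>i\<in>S. (int d - int i) * a i) = int d * fst \<alpha> - snd \<alpha>"
        unfolding s1[symmetric] s2[symmetric]
        by (simp add: left_diff_distrib sum_subtractf sum_distrib_left)
      moreover have "a i \<le> (\<Sum>i\<in>S. (int d - int i) * a i)" if i: "i \<in> S" "i \<noteq> d" for i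
      proof -
        have "1 * a i \<le> (int d - int i) * a i"
          using nn[OF i] le_d[OF i(1)] i(2) by (intro mult_right_mono) auto
        also have "\<dots> \<le> (\<Sum>i\<in>S. (int d - int i) * a i)"
        proof (rule member_le_sum[OF i(1) _ finite])
          fix i' assume i': "i' \<in> S - {i}"
          show "0 \<le> (int d - int i') * a i'"
            using nn[of i'] le_d[of i'] i' by (cases "i' = d") auto
        qed
        finally show ?thesis by simp
      qed
      ultimately have "a i \<le> B0" if "i \<in> S" "i \<noteq> d" for i
        using that unfolding B0_def by fastforce
      then show ?thesis using *[OF d_in _ s1 j] nn by blast
    next
      case False
      with or have d: "a d \<ge> 0" by simp
      have nn: "0 \<le> a i" if "i \<in> S" "i \<noteq> 0" for i
        using d int that le_d[OF that(1)] by (cases "i = d") auto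
      have "a i \<le> (\<Sum>i\<in>S. int i * a i)" if i: "i \<in> S" "i \<noteq> 0" for i
      proof -
        have "1 * a i \<le> int i * a i"
          using nn[OF i] i(2) by (intro mult_right_mono) auto
        also have "\<dots> \<le> (\<Sum>i\<in>S. int i * a i)"
        proof (rule member_le_sum[OF i(1) _ finite])
          fix i' assume i': "i' \<in> S - {i}"
          show "0 \<le> int i' * a i'"
            using nn[of i'] i' by (cases "i' = 0") auto
        qed
        finally show ?thesis by simp
      qed
      then have "a i \<le> B0" if "i \<in> S" "i \<noteq> 0" for i
        using that s2 unfolding B0_def by fastforce
      then show ?thesis using *[OF zero_in _ s1 j] nn by blast
    qed
  qed
  then show ?thesis by blast
qed

text \<open>
  This is where rationality enters. Suppose that some exponent of the support is negative
  at both end points, and let \<open>a\<close> be such an exponent of least weight with respect to the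
  interior variables other than \<open>x\<^sub>k\<close>. On the line through \<open>a\<close> in direction
  \<open>dir d k\<close> the equation \<open>q f = p\<close> becomes a linear recurrence with constant coefficients:
  far out on that line neither \<open>p\<close> nor exponents that are nonnegative at an end point interfere
  (those have bounded coordinates), and by the choice of \<open>a\<close> only the lowest part \<open>T\<close> of
  \<open>q\<close> contributes, whose exponents differ by rational multiples of \<open>dir d k\<close>. On the other
  hand the box relations make the coefficients along the line a factorial quotient, and these two facts
  contradict each other.
\<close>

lemma no_doubly_negative:
  assumes H: "hypergeometric_series S \<alpha> f"
    and int: "\<And>a j. f a \<noteq> 0 \<Longrightarrow> j \<in> S \<Longrightarrow> 0 < j \<Longrightarrow> j < d \<Longrightarrow> a j \<ge> 0"
    and k: "k \<in> S" "0 < k" "k < d"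
    and q: "q \<noteq> 0" "mvars q \<subseteq> S" "act q f = act p one_series"
    and w: "\<And>j. j \<in> S \<Longrightarrow> w j \<ge> 0"
    and generic: "\<And>b b' j. b \<in> Poly_Mapping.keys q \<Longrightarrow> b' \<in> Poly_Mapping.keys q \<Longrightarrow>
      wdeg (S - {0, d, k}) w (\<lambda>j. int (Poly_Mapping.lookup b j)) =
      wdeg (S - {0, d, k}) w (\<lambda>j. int (Poly_Mapping.lookup b' j)) \<Longrightarrow>
      j \<in> S - {0, d, k} \<Longrightarrow> Poly_Mapping.lookup b j = Poly_Mapping.lookup b' j"
    and a': "f a' \<noteq> 0"
  shows "a' 0 \<ge> 0 \<or> a' d \<ge> 0"
proof (rule ccontr)
  assume "\<not> ?thesis"
  then have a'neg: "a' 0 < 0 \<and> a' d < 0" by auto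
  define S' where "S' = S - {0, d, k}"
  define wt where "wt = wdeg S' w"
  define e :: "(nat \<Rightarrow>\<^sub>0 nat) \<Rightarrow> nat \<Rightarrow> int" where "e b j = int (Poly_Mapping.lookup b j)" for b j
  have S: "S = insert 0 (insert d (insert k S'))" "0 \<notin> S'" "d \<notin> S'" "k \<notin> S'" "finite S'"
    using zero_in d_in k finite by (auto simp: S'_def)
  have split: "(\<Sum>j\<in>S. g j) = g 0 + g d + g k + (\<Sum>j\<in>S'. g j)" for g :: "nat \<Rightarrow> int"
    unfolding S(1) using S k by (simp add: add_ac)
  have out: "x j = 0" if "f x \<noteq> 0" "j \<notin> S" for x j
    using H that by (auto simp: hypergeometric_series_def)
  have level: "mat_vec S x = \<alpha>" if "f x \<noteq> 0" for x
    using H that by (auto simp: hypergeometric_series_def)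
  have wt_nonneg: "wt x \<ge> 0" if "f x \<noteq> 0" for x
    unfolding wt_def wdeg_def
    by (intro sum_nonneg mult_nonneg_nonneg int[OF that] w)
      (use le_d in \<open>auto simp: S'_def order_le_less\<close>)
  obtain a where a: "f a \<noteq> 0" "a 0 < 0" "a d < 0"
    and least: "\<And>x. f x \<noteq> 0 \<Longrightarrow> x 0 < 0 \<Longrightarrow> x d < 0 \<Longrightarrow> wt a \<le> wt x"
  proof -
    obtain a where a: "f a \<noteq> 0 \<and> a 0 < 0 \<and> a d < 0"
      and l: "\<And>x. f x \<noteq> 0 \<and> x 0 < 0 \<and> x d < 0 \<Longrightarrow> nat (wt a) \<le> nat (wt x)"
      using ex_has_least_nat[of "\<lambda>x. f x \<noteq> 0 \<and> x 0 < 0 \<and> x d < 0" a' "\<lambda>x. nat (wt x)"] a' a'neg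
      by blast
    have "wt a \<le> wt x" if "f x \<noteq> 0" "x 0 < 0" "x d < 0" for x
      using l[of x] wt_nonneg[of x] that by (simp add: nat_le_eq_zle)
    with a show thesis using that by blast
  qed
  have ak: "a k \<ge> 0" using int a k by blast
  obtain B where "\<forall>x. mat_vec S x = \<alpha> \<longrightarrow> (\<forall>j\<in>S. 0 < j \<longrightarrow> j < d \<longrightarrow> x j \<ge> 0) \<longrightarrow>
    (x 0 \<ge> 0 \<or> x d \<ge> 0) \<longrightarrow> (\<forall>j\<in>S. \<bar>x j\<bar> \<le> B)"
    using level_bounds by blast
  then have B: "x k \<le> B" if "f x \<noteq> 0" "x 0 \<ge> 0 \<or> x d \<ge> 0" for x
    using that level[OF that(1)] int[OF that(1)] k(1) by fastforce
  obtain b1 where b1: "b1 \<in> Poly_Mapping.keys q"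
    and b1_least: "\<And>b. b \<in> Poly_Mapping.keys q \<Longrightarrow> wt (e b1) \<le> wt (e b)"
  proof -
    let ?W = "(\<lambda>b. wt (e b)) ` Poly_Mapping.keys q"
    have W: "finite ?W" "?W \<noteq> {}" using q(1) by auto
    obtain b1 where b1: "b1 \<in> Poly_Mapping.keys q" "Min ?W = wt (e b1)"
      using Min_in[OF W] by auto
    show thesis
    proof (rule that[OF b1(1)])
      fix b assume "b \<in> Poly_Mapping.keys q"
      then show "wt (e b1) \<le> wt (e b)" unfolding b1(2)[symmetric] by (intro Min_le[OF W(1)] imageI)
    qed
  qed
  define T where "T = {b \<in> Poly_Mapping.keys q. (\<forall>j\<in>S'. e b j = e b1 j) \<and> mat_vec S (e b) = mat_vec S (e b1)}"
  have T: "finite T" "T \<noteq> {}" using b1 by (auto simp: T_def)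
  obtain b0 where b0: "b0 \<in> T" and b0_least: "\<And>b. b \<in> T \<Longrightarrow> Poly_Mapping.lookup b0 k \<le> Poly_Mapping.lookup b k"
    using ex_has_least_nat[of "\<lambda>b. b \<in> T" _ "\<lambda>b. Poly_Mapping.lookup b k"] T(2) by blast
  have e_out: "e b j = 0" if "b \<in> Poly_Mapping.keys q" "j \<notin> S" for b j
  proof (rule ccontr)
    assume "e b j \<noteq> 0"
    then have "j \<in> mvars q" using that by (auto simp: e_def mvars_def in_keys_iff)
    then show False using q(2) that by auto
  qed
  have T_eq: "e b j = e b0 j" if "b \<in> T" "j \<in> S'" for b j
    using that b0 by (auto simp: T_def)
  have T_level: "mat_vec S (e b) = mat_vec S (e b0)" if "b \<in> T" for b
    using that b0 by (auto simp: T_def)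
  \<comment> \<open>The distance of \<open>b\<close> from the first exponent \<open>b0\<close> of \<open>T\<close>, measured in
    coordinate \<open>k\<close>; the choice of \<open>b0\<close> makes this subtraction of naturals exact.\<close>
  define s where "s b = Poly_Mapping.lookup b k - Poly_Mapping.lookup b0 k" for b
  have s: "int (s b) = e b k - e b0 k" if "b \<in> T" for b
    using b0_least[OF that] by (simp add: s_def e_def)
  \<comment> \<open>The line is parametrized by coordinate \<open>k\<close>. Where the two end coordinates would not
    be integers, rounding moves the point off the fibre of \<open>\<alpha>\<close>, and \<open>f\<close> vanishes
    there as it should.\<close>
  define pt where "pt n = a(k := n, d := a d - (int k * (n - a k)) div int d,
    0 := a 0 - (n - a k) + (int k * (n - a k)) div int d)" for n
  have pt: "pt n k = n" "pt n d = a d - (int k * (n - a k)) div int d"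
    "pt n 0 = a 0 - (n - a k) + (int k * (n - a k)) div int d"
    "j \<in> S' \<Longrightarrow> pt n j = a j" "j \<notin> S \<Longrightarrow> pt n j = 0" for n j
    using k S out[OF a(1)] by (auto simp: pt_def)
  have wt_pt: "wt (pt n) = wt a" for n
    unfolding wt_def wdeg_def by (intro sum.cong refl) (simp add: pt)
  have mat_pt: "mat_vec S (pt n) = (fst \<alpha>, snd \<alpha> + (int k * (n - a k)) mod int d)" for n
  proof -
    have "(\<Sum>j\<in>S'. int j * pt n j) = (\<Sum>j\<in>S'. int j * a j)" "(\<Sum>j\<in>S'. pt n j) = (\<Sum>j\<in>S'. a j)"
      by (intro sum.cong refl; simp add: pt)+
    moreover have "int d * ((int k * (n - a k)) div int d) + (int k * (n - a k)) mod int d = int k * (n - a k)"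
      by simp
    ultimately show ?thesis
      using level[OF a(1)] by (auto simp: mat_vec_def split pt algebra_simps)
  qed
  have pt_unique: "x = pt (x k)"
    if "\<And>j. j \<in> S' \<Longrightarrow> x j = a j" "\<And>j. j \<notin> S \<Longrightarrow> x j = 0" "mat_vec S x = \<alpha>" for x
  proof -
    have "(\<Sum>j\<in>S'. int j * x j) = (\<Sum>j\<in>S'. int j * a j)" "(\<Sum>j\<in>S'. x j) = (\<Sum>j\<in>S'. a j)"
      by (intro sum.cong refl; simp add: that)+
    then have 1: "x 0 + x d + x k = a 0 + a d + a k" and 2: "int d * x d + int k * x k = int d * a d + int k * a k"
      using that(3) level[OF a(1)] by (auto simp: mat_vec_def split)
    have "int k * (x k - a k) = int d * (a d - x d)" using 2 by (simp add: algebra_simps)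
    then have 3: "(int k * (x k - a k)) div int d = a d - x d" using d_pos by simp
    show ?thesis
    proof
      fix j
      consider "j = 0" | "j = d" | "j = k" | "j \<in> S'" | "j \<notin> S" using S(1) by blast
      then show "x j = pt (x k) j"
        by cases (use 1 3 that in \<open>auto simp: pt\<close>)
    qed
  qed
  \<comment> \<open>From \<open>n1\<close> on, a point of the line lies beyond the support of \<open>p\<close> and beyond the
    bound \<open>B\<close>, even after subtraction of any exponent of \<open>q\<close>.\<close>
  define n1 where "n1 = nat \<bar>B\<bar> + (\<Sum>b\<in>Poly_Mapping.keys p. Poly_Mapping.lookup b k) +
    (\<Sum>b\<in>Poly_Mapping.keys q. Poly_Mapping.lookup b k) + 1"
  have n1_p: "Poly_Mapping.lookup b k < n1" if "b \<in> Poly_Mapping.keys p" for b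
    using member_le_sum[of b "Poly_Mapping.keys p" "\<lambda>b. Poly_Mapping.lookup b k"] that
    by (simp add: n1_def)
  have n1_q: "nat \<bar>B\<bar> + Poly_Mapping.lookup b k < n1" if "b \<in> Poly_Mapping.keys q" for b
    using member_le_sum[of b "Poly_Mapping.keys q" "\<lambda>b. Poly_Mapping.lookup b k"] that
    by (simp add: n1_def)
  have line: "(\<Sum>b\<in>T. Poly_Mapping.lookup q b * f (pt (int n - int (s b)))) = 0" if n: "n \<ge> n1" for n
  proof (cases "(int k * (int n - a k)) mod int d = 0")
    case True
    define c where "c = (\<lambda>j. pt (int n) j + e b0 j)"
    have lev_c: "mat_vec S (\<lambda>j. c j - e b j) = \<alpha> \<longleftrightarrow> mat_vec S (e b) = mat_vec S (e b0)" for b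
      using mat_pt[of "int n"] True
      by (cases \<alpha>) (auto simp: c_def mat_vec_def sum.distrib sum_subtractf distrib_left right_diff_distrib)
    have in_T: "b \<in> T" if b: "b \<in> Poly_Mapping.keys q" and nz: "f (\<lambda>j. c j - e b j) \<noteq> 0" for b
    proof -
      let ?x = "\<lambda>j. c j - e b j"
      have "?x k > B" using n n1_q[OF b] by (simp add: c_def pt e_def)
      then have "?x 0 < 0" "?x d < 0" using B[OF nz] by force+
      then have "wt a \<le> wt ?x" using least[OF nz] by blast
      also have "wt ?x = wt a + wt (e b0) - wt (e b)"
        unfolding c_def wt_def wdeg_diff wdeg_add using wt_pt[of "int n"] by (simp add: wt_def)
      finally have "wt (e b) \<le> wt (e b0)" by simp
      moreover have b0q: "b0 \<in> Poly_Mapping.keys q" using b0 by (simp add: T_def)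
      moreover have "wt (e b0) = wt (e b1)"
        unfolding wt_def wdeg_def using b0 by (intro sum.cong refl) (simp add: T_def)
      ultimately have "wt (e b) = wt (e b1)" using b1_least[OF b] by simp
      then have "e b j = e b1 j" if "j \<in> S'" for j
        using generic[OF b b1, of j] that by (simp add: wt_def e_def[abs_def] S'_def)
      moreover have "mat_vec S (e b) = mat_vec S (e b1)"
        using level[OF nz] lev_c b0 by (simp add: T_def)
      ultimately show ?thesis using b by (simp add: T_def)
    qed
    have "act q f c = (\<Sum>b\<in>T. Poly_Mapping.lookup q b * f (\<lambda>j. c j - e b j))"
      unfolding act_def e_def[symmetric]
      by (rule sum.mono_neutral_right) (use in_T in \<open>auto simp: T_def\<close>)
    also have "\<dots> = (\<Sum>b\<in>T. Poly_Mapping.lookup q b * f (pt (int n - int (s b))))"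
    proof (rule sum.cong)
      fix b assume b: "b \<in> T"
      then have bq: "b \<in> Poly_Mapping.keys q" and b0q: "b0 \<in> Poly_Mapping.keys q"
        using b0 by (auto simp: T_def)
      have "(\<lambda>j. c j - e b j) = pt (c k - e b k)"
      proof (rule pt_unique)
        show "c j - e b j = a j" if "j \<in> S'" for j
          using T_eq[OF b that] by (simp add: c_def pt that)
        show "c j - e b j = 0" if "j \<notin> S" for j
          using that e_out bq b0q by (simp add: c_def pt)
        show "mat_vec S (\<lambda>j. c j - e b j) = \<alpha>" using lev_c T_level[OF b] by simp
      qed
      moreover have "c k - e b k = int n - int (s b)" using s[OF b] by (simp add: c_def pt)
      ultimately show "Poly_Mapping.lookup q b * f (\<lambda>j. c j - e b j) =
          Poly_Mapping.lookup q b * f (pt (int n - int (s b)))" by simp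
    qed simp
    finally have eq: "act q f c = (\<Sum>b\<in>T. Poly_Mapping.lookup q b * f (pt (int n - int (s b))))" .
    have "act q f c = 0"
    proof (rule ccontr)
      assume "act q f c \<noteq> 0"
      then have "act p one_series c \<noteq> 0" using q(3) by simp
      then obtain b where b: "b \<in> Poly_Mapping.keys p" "c = (\<lambda>j. int (Poly_Mapping.lookup b j))"
        by (rule act_one_series_nonzeroE)
      have "c k \<ge> int n" by (simp add: c_def pt e_def)
      then show False using b n1_p[OF b(1)] n by simp
    qed
    with eq show ?thesis by simp
  next
    case False
    have "f (pt (int n - int (s b))) = 0" if b: "b \<in> T" for b
    proof (rule ccontr)
      assume "f (pt (int n - int (s b))) \<noteq> 0"
      then have "(int k * (int n - int (s b) - a k)) mod int d = 0"
        using level mat_pt[of "int n - int (s b)"] by (cases \<alpha>) simp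
      then have 1: "int d dvd int k * (int n - int (s b) - a k)" by (simp add: dvd_eq_mod_eq_0)
      have sums: "(\<Sum>j\<in>S'. int j * e b j) = (\<Sum>j\<in>S'. int j * e b0 j)"
        by (intro sum.cong refl) (simp add: T_eq[OF b])
      have "int d * e b d + int k * e b k = int d * e b0 d + int k * e b0 k"
        using T_level[OF b] sums by (simp add: mat_vec_def split)
      then have "int k * int (s b) = int d * (e b0 d - e b d)" by (simp add: s[OF b] algebra_simps)
      then have 2: "int d dvd int k * int (s b)" by simp
      have "int d dvd int k * (int n - a k)"
        using dvd_add[OF 1 2] by (simp add: algebra_simps)
      then show False using False by (simp add: dvd_eq_mod_eq_0)
    qed
    then show ?thesis by simp
  qed
  define h where "h = (\<Sum>b\<in>T. monom (Poly_Mapping.lookup q b) (s b))"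
  define F where "F = Abs_fps (\<lambda>n. f (pt (int n)))"
  have h: "h \<noteq> 0"
  proof -
    have "b = b0" if b: "b \<in> T" and "s b = 0" for b
    proof (rule poly_mapping_eqI)
      fix j
      have ek: "e b k = e b0 k" using s[OF b] that(2) by simp
      have sums: "(\<Sum>j\<in>S'. int j * e b j) = (\<Sum>j\<in>S'. int j * e b0 j)" "(\<Sum>j\<in>S'. e b j) = (\<Sum>j\<in>S'. e b0 j)"
        by (intro sum.cong refl; simp add: T_eq[OF b])+
      have "int d * e b d = int d * e b0 d" "e b 0 + e b d = e b0 0 + e b0 d"
        using T_level[OF b] sums ek by (simp_all add: mat_vec_def split)
      then have ed: "e b d = e b0 d" "e b 0 = e b0 0" using d_pos by simp_all
      have bq: "b \<in> Poly_Mapping.keys q" and b0q: "b0 \<in> Poly_Mapping.keys q"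
        using b b0 by (auto simp: T_def)
      consider "j = 0" | "j = d" | "j = k" | "j \<in> S'" | "j \<notin> S" using S(1) by blast
      then have "e b j = e b0 j"
        by cases (simp_all add: ek ed T_eq[OF b] e_out[OF bq] e_out[OF b0q])
      then show "Poly_Mapping.lookup b j = Poly_Mapping.lookup b0 j" by (simp add: e_def)
    qed
    then have "coeff h 0 = (\<Sum>b\<in>T. if b = b0 then Poly_Mapping.lookup q b0 else 0)"
      unfolding h_def coeff_sum by (intro sum.cong refl) (auto simp: s_def)
    also have "\<dots> \<noteq> 0" using b0 T(1) by (simp add: T_def in_keys_iff)
    finally show ?thesis by auto
  qed
  have van: "fps_nth (fps_of_poly h * F) n = 0" if n: "n \<ge> n1" for n
  proof -
    have "fps_nth (fps_of_poly h * F) n = (\<Sum>b\<in>T. fps_nth (fps_of_poly (monom (Poly_Mapping.lookup q b) (s b)) * F) n)"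
      by (simp add: h_def fps_of_poly_sum sum_distrib_right fps_sum_nth)
    also have "\<dots> = (\<Sum>b\<in>T. Poly_Mapping.lookup q b * f (pt (int n - int (s b))))"
    proof (rule sum.cong)
      fix b assume "b \<in> T"
      then have "s b \<le> n" using n n1_q[of b] by (simp add: T_def s_def)
      then show "fps_nth (fps_of_poly (monom (Poly_Mapping.lookup q b) (s b)) * F) n =
          Poly_Mapping.lookup q b * f (pt (int n - int (s b)))"
        unfolding fps_monom_mult_nth by (simp add: F_def of_nat_diff)
    qed simp
    finally show ?thesis using line[OF n] by simp
  qed
  \<comment> \<open>A step of \<open>M\<close> times \<open>dir d k\<close> is longer than each of the three coordinates at which the
    line starts. This is what places the zeros and the pole of the quotient of successive
    coefficients all at \<open>l = - 1\<close>.\<close>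
  define M where "M = nat (\<bar>a 0\<bar> + \<bar>a d\<bar> + a k + 1)"
  define N where "N = M * d"
  have M: "\<bar>a 0\<bar> < int M" "\<bar>a d\<bar> < int M" "a k < int M" "M > 0"
    using ak by (auto simp: M_def)
  have scale: "x < int M \<Longrightarrow> y \<ge> 1 \<Longrightarrow> x < int M * y" for x y :: int
    using mult_left_mono[of 1 y "int M"] by simp
  have "N \<ge> 1" using M d_pos by (simp add: N_def Suc_leI)
  from section_recurrence[OF h this van, where ?n0.0 = "nat (a k)"]
  obtain g r l0 where g: "g 0 \<noteq> (0::complex)"
    and lin: "\<And>l. l \<ge> l0 \<Longrightarrow> (\<Sum>i\<le>r. g i * fps_nth F (nat (a k) + N * (l + i))) = 0"
    by blast
  define x where "x l = (\<lambda>i. a i + (int M * int l) * dir d k i)" for l :: nat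
  have x: "x l k = a k + int N * int l" "x l 0 = a 0 - int M * (int d - int k) * int l"
    "x l d = a d - int M * int k * int l" "j \<noteq> 0 \<Longrightarrow> j \<noteq> d \<Longrightarrow> j \<noteq> k \<Longrightarrow> x l j = a j" for l j
    using k by (auto simp: x_def dir_def N_def algebra_simps)
  have x_level: "mat_vec S (x l) = \<alpha>" for l
    using mat_vec_dir[OF k(1)] level[OF a(1)] by (simp add: x_def)
  have x_out: "x l j = 0" if "j \<notin> S" for l j
    using that S(1) out[OF a(1)] by (subst x) auto
  have Fx: "fps_nth F (nat (a k) + N * l) = f (x l)" for l
  proof -
    have "x l = pt (x l k)"
      by (rule pt_unique) (use x_level x_out in \<open>auto simp: x S'_def\<close>)
    then show ?thesis using ak by (simp add: F_def x)
  qed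
  define u v where "u = int M * (int d - int k)" and "v = int M * int k"
  have nz: "f (x l) \<noteq> 0" for l
    using H finite a(1)
  proof (rule hypergeometric_series_support)
    show "mat_vec S a = mat_vec S (x l)" using x_level level[OF a(1)] by simp
    show "a j < 0" if "j \<in> S" "x l j < 0" for j
    proof (cases "j = 0 \<or> j = d")
      case False
      then have "x l j \<ge> a j" by (cases "j = k") (auto simp: x)
      then show ?thesis using that(2) by simp
    qed (use a in auto)
  qed (rule x_out)
  have prod_split: "(\<Prod>j\<in>S. g j) = g k * g 0 * g d" if "\<And>j. j \<in> S' \<Longrightarrow> g j = 1" for g :: "nat \<Rightarrow> complex"
    unfolding S(1) using S k that by (simp add: mult_ac)
  have neg_prod: "(\<Prod>i\<in>{z - t * (int l + 1)<..z - t * int l}. of_int i :: complex) =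
      (- 1) ^ nat t * (\<Prod>i\<in>{(- z - 1) + t * int l<..(- z - 1) + t * (int l + 1)}. of_int i)"
    if "t \<ge> 0" for z t l
  proof -
    have "(\<Prod>i\<in>{z - t * (int l + 1)<..z - t * int l}. of_int i :: complex) =
        (\<Prod>i\<in>{(- z - 1) + t * int l<..(- z - 1) + t * (int l + 1)}. (- 1) * of_int i)"
      by (rule prod.reindex_bij_witness[of _ uminus uminus]) auto
    also have "\<dots> = (\<Prod>i\<in>{(- z - 1) + t * int l<..(- z - 1) + t * (int l + 1)}. - 1) *
        (\<Prod>i\<in>{(- z - 1) + t * int l<..(- z - 1) + t * (int l + 1)}. of_int i)"
      by (rule prod.distrib)
    finally show ?thesis by (simp add: distrib_left)
  qed
  show False
  proof (rule factorial_quotient_no_linear_recurrence[of "a k" "int N" "- a 0 - 1" u "- a d - 1" v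
        "(- 1) ^ nat u * (- 1) ^ nat v" "\<lambda>l. f (x l)" g l0 r])
    show "0 \<le> a k" "0 \<le> - a 0 - 1" "0 \<le> - a d - 1" using ak a by auto
    show "a k < int N" using scale[of "a k" "int d"] M d_pos by (simp add: N_def)
    show "- a 0 - 1 < u" using scale[of "- a 0 - 1" "int d - int k"] M k by (simp add: u_def)
    show "- a d - 1 < v" using scale[of "- a d - 1" "int k"] M k by (simp add: v_def)
    show "(\<Sum>i\<le>r. g i * f (x (l + i))) = 0" if "l \<ge> l0" for l
      using lin[OF that] unfolding Fx .
    show "f (x (Suc l)) * (\<Prod>i\<in>{a k + int N * int l<..a k + int N * (int l + 1)}. of_int i) =
      f (x l) * ((- 1) ^ nat u * (- 1) ^ nat v *
        (\<Prod>i\<in>{(- a 0 - 1) + u * int l<..(- a 0 - 1) + u * (int l + 1)}. of_int i) *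
        (\<Prod>i\<in>{(- a d - 1) + v * int l<..(- a d - 1) + v * (int l + 1)}. of_int i))" for l
    proof -
      have uv: "u \<ge> 0" "v \<ge> 0" using k by (auto simp: u_def v_def)
      have ul: "u * int l \<le> u * (int l + 1)" "v * int l \<le> v * (int l + 1)" "int N * int l \<le> int N * (int l + 1)"
        using uv by (auto intro!: mult_left_mono)
      have sl: "int (Suc l) = int l + 1" by simp
      have xs: "x l 0 = a 0 - u * int l" "x l d = a d - v * int l" for l
        by (simp_all add: x u_def v_def)
      have xS': "x l j = a j" if "j \<in> S'" for l j
        by (rule x(4)) (use that S(2-4) in metis)+
      have "f (x (Suc l)) * (\<Prod>j\<in>S. \<Prod>i\<in>{x l j<..x (Suc l) j}. of_int i) =
          f (x l) * (\<Prod>j\<in>S. \<Prod>i\<in>{x (Suc l) j<..x l j}. of_int i)"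
        by (rule hypergeometric_series_box[OF H]) (simp_all add: x_level x_out)
      also have "(\<Prod>j\<in>S. \<Prod>i\<in>{x l j<..x (Suc l) j}. of_int i :: complex) =
          (\<Prod>i\<in>{a k + int N * int l<..a k + int N * (int l + 1)}. of_int i)"
        by (subst prod_split) (use ul in \<open>auto simp: xs xS' x(1) sl simp del: of_nat_Suc\<close>)
      also have "(\<Prod>j\<in>S. \<Prod>i\<in>{x (Suc l) j<..x l j}. of_int i :: complex) =
          (\<Prod>i\<in>{a 0 - u * (int l + 1)<..a 0 - u * int l}. of_int i) *
          (\<Prod>i\<in>{a d - v * (int l + 1)<..a d - v * int l}. of_int i)"
        by (subst prod_split) (use ul in \<open>auto simp: xs xS' x(1) sl simp del: of_nat_Suc\<close>)
      finally show ?thesis unfolding neg_prod[OF uv(1)] neg_prod[OF uv(2)] by (simp add: mult_ac)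
    qed
  qed (use nz g in auto)
qed

end

section \<open>Canonical solutions\<close>

text \<open>
  The reciprocal factorial, continued to negative arguments by its recursion
  \<open>n F n = F (n - 1)\<close>. At \<open>n = 0\<close> the recursion would force \<open>F (- 1) = 0\<close>, so it
  is dropped there, and the negative range can be normalized separately; the normalization chosen
  is the one that occurs in
  \<open>\<Psi>\<^sub>0\<close> and \<open>\<Psi>\<^sub>d\<close>.
\<close>

definition inv_fact :: "int \<Rightarrow> complex" where
  "inv_fact n = (if n \<ge> 0 then inverse (fact (nat n)) else (- 1) ^ nat (- n) * fact (nat (- n) - 1))"

lemma inv_fact_nonzero: "inv_fact n \<noteq> 0"
  by (simp add: inv_fact_def)

lemma inv_fact_rec:
  assumes "n \<noteq> 0" shows "of_int n * inv_fact n = inv_fact (n - 1)"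
proof (cases "n > 0")
  case True
  then obtain m where m: "n = int (Suc m)" by (metis gr0_implies_Suc zero_less_imp_eq_int)
  have "inv_fact (n - 1) = inverse (fact m)" by (simp add: inv_fact_def m)
  moreover have "inv_fact n = inverse (of_nat (Suc m) * fact m)"
    unfolding inv_fact_def m by (simp only: nat_int fact_Suc) simp
  ultimately show ?thesis using m by (simp del: of_nat_Suc)
next
  case False
  define m where "m = nat (- n) - 1"
  have n: "n = - int (Suc m)" using False assms by (simp add: m_def)
  have 1: "inv_fact n = (- 1) ^ Suc m * fact m" by (simp add: inv_fact_def n nat_add_distrib)
  have "nat (- (n - 1)) = Suc (Suc m)" using n by simp
  then have 2: "inv_fact (n - 1) = (- 1) ^ Suc (Suc m) * (of_nat (Suc m) * fact m)"
    using n unfolding inv_fact_def by (simp del: of_nat_Suc)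
  show ?thesis unfolding 1 2 by (simp add: n algebra_simps)
qed

lemma inv_fact_prod:
  assumes "x \<le> y" "x < 0 \<longleftrightarrow> y < 0"
  shows "inv_fact y * (\<Prod>i\<in>{x<..y}. of_int i) = inv_fact x"
  using assms
proof (induction y rule: int_ge_induct)
  case (step y)
  have s: "x < 0 \<longleftrightarrow> y < 0" using step.prems step.hyps by auto
  have "y + 1 \<noteq> 0" using step.prems step.hyps by auto
  then have "inv_fact (y + 1) * of_int (y + 1) = inv_fact y"
    using inv_fact_rec[of "y + 1"] by (simp add: mult.commute del: of_int_add)
  moreover have "{x<..y + 1} = insert (y + 1) {x<..y}" using step.hyps by auto
  then have "(\<Prod>i\<in>{x<..y + 1}. of_int i :: complex) = of_int (y + 1) * (\<Prod>i\<in>{x<..y}. of_int i)"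
    by (simp del: of_int_add)
  ultimately show ?case using step.IH[OF s] by (simp add: mult.assoc[symmetric] del: of_int_add)
qed simp

lemma inv_fact_prod_swap:
  assumes "x < 0 \<longleftrightarrow> y < 0"
  shows "inv_fact y * (\<Prod>i\<in>{x<..y}. of_int i) = inv_fact x * (\<Prod>i\<in>{y<..x}. of_int i)"
proof (cases "x \<le> y")
  case True
  then show ?thesis using inv_fact_prod[OF True assms] by simp
next
  case False
  then show ?thesis using inv_fact_prod[of y x] assms by simp
qed

definition canonical_series :: "nat set \<Rightarrow> int \<times> int \<Rightarrow> nat set \<Rightarrow> series" where
  "canonical_series S \<alpha> N a =
    (if (\<forall>j. j \<notin> S \<longrightarrow> a j = 0) \<and> mat_vec S a = \<alpha> \<and> {j \<in> S. a j < 0} = N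
     then \<Prod>j\<in>S. inv_fact (a j) else 0)"

lemma canonical_series_eq_0: "{j \<in> S. a j < 0} \<noteq> N \<Longrightarrow> canonical_series S \<alpha> N a = 0"
  by (auto simp: canonical_series_def)

text \<open>
  Between exponents with the same negative coordinates all factors in the box relation are
  nonzero, so one coefficient determines the others.
\<close>

lemma canonical_series_coefficient:
  assumes H: "hypergeometric_series S \<alpha> f" and S: "finite S"
  shows "\<exists>c. \<forall>a. {j \<in> S. a j < 0} = N \<longrightarrow> f a = c * canonical_series S \<alpha> N a"
proof (cases "\<exists>a. f a \<noteq> 0 \<and> {j \<in> S. a j < 0} = N")
  case True
  then obtain b where b: "f b \<noteq> 0" "{j \<in> S. b j < 0} = N" by blast
  have out: "\<And>j. f x \<noteq> 0 \<Longrightarrow> j \<notin> S \<Longrightarrow> x j = 0" and lev: "f x \<noteq> 0 \<Longrightarrow> mat_vec S x = \<alpha>" for x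
    using H by (auto simp: hypergeometric_series_def)
  let ?G = "\<lambda>a. \<Prod>j\<in>S. inv_fact (a j)"
  have G: "?G b \<noteq> 0" using S by (simp add: inv_fact_nonzero)
  have "f a = f b / ?G b * canonical_series S \<alpha> N a" if N: "{j \<in> S. a j < 0} = N" for a
  proof (cases "(\<forall>j. j \<notin> S \<longrightarrow> a j = 0) \<and> mat_vec S a = \<alpha>")
    case True
    let ?P = "\<Prod>j\<in>S. \<Prod>i\<in>{b j<..a j}. of_int i :: complex"
    let ?Q = "\<Prod>j\<in>S. \<Prod>i\<in>{a j<..b j}. of_int i :: complex"
    have sgn: "b j < 0 \<longleftrightarrow> a j < 0" if "j \<in> S" for j using N b(2) that by blast
    have P: "?P \<noteq> 0" using S sgn by (auto simp: prod_zero_iff)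
    have 1: "f a * ?P = f b * ?Q"
      using True out[OF b(1)] lev[OF b(1)] by (intro hypergeometric_series_box[OF H]) auto
    have 2: "?G a * ?P = ?G b * ?Q"
      unfolding prod.distrib[symmetric] by (intro prod.cong refl inv_fact_prod_swap sgn)
    have "f a * ?G b * ?P = f b * ?G a * ?P" using 1 2 by (simp add: mult_ac)
    then have "f a * ?G b = f b * ?G a" using P by simp
    then show ?thesis using True N G by (simp add: canonical_series_def field_simps)
  next
    case False
    then have "f a = 0" using out[of a] lev[of a] by blast
    with False show ?thesis by (auto simp: canonical_series_def)
  qed
  then show ?thesis by blast
next
  case False
  then show ?thesis by (intro exI[of _ 0]) auto
qed

context weighted
begin

lemma expands_monomial:
  assumes "finite T"
  shows "expands (\<Prod>j\<in>T. rf_var j powi e j) (\<lambda>a. if a = (\<lambda>j. if j \<in> T then e j else 0) then 1 else 0)"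
  using assms
proof (induction T)
  case empty
  show ?case using expands_one by (simp add: one_series_def[abs_def])
next
  case (insert k T)
  have "a(k := a k - e k) = (\<lambda>j. if j \<in> T then e j else 0) \<longleftrightarrow> a = (\<lambda>j. if j \<in> insert k T then e j else 0)" for a
    using insert(2) unfolding fun_eq_iff by (metis diff_eq_eq add_0 eq_iff_diff_eq_0 fun_upd_apply insert_iff)
  then have "expands ((\<Prod>j\<in>T. rf_var j powi e j) * rf_var k powi e k)
      (\<lambda>a. if a = (\<lambda>j. if j \<in> insert k T then e j else 0) then 1 else 0)"
    using expands_var_powi[OF insert.IH, of k "e k"] by (simp only:)
  then show ?case using insert by (simp add: mult.commute)
qed

lemma expands_hyp_poly:
  assumes T: "finite T"
  shows "expands (hyp_poly T \<beta>) (canonical_series T \<beta> {})"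
proof -
  define e :: "(nat \<Rightarrow>\<^sub>0 nat) \<Rightarrow> nat \<Rightarrow> int" where "e u j = int (Poly_Mapping.lookup u j)" for u j
  define c where "c u = (\<Prod>j\<in>T. inverse (fact (Poly_Mapping.lookup u j) :: complex))" for u :: "nat \<Rightarrow>\<^sub>0 nat"
  let ?U = "solution_exponents T \<beta>"
  have rf_const_prod: "rf_const (\<Prod>j\<in>T. g j) = (\<Prod>j\<in>T. rf_const (g j))" for g :: "nat \<Rightarrow> complex"
    using T by (induction T) (simp_all add: rf_const_mult)
  have summand: "(\<Prod>j\<in>T. rf_var j ^ Poly_Mapping.lookup u j / of_nat (fact (Poly_Mapping.lookup u j))) =
      rf_const (c u) * (\<Prod>j\<in>T. rf_var j powi e u j)" for u
  proof -
    have "rf_const (fact n) = of_nat (fact n)" for n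
      by (metis of_nat_fact rf_const_of_nat)
    then have "rf_const (inverse (fact n)) = inverse (of_nat (fact n))" for n
      by (simp only: rf_const_inverse)
    then show ?thesis
      by (simp add: c_def rf_const_prod e_def divide_inverse prod.distrib mult.commute)
  qed
  have "expands (hyp_poly T \<beta>) (\<lambda>a. \<Sum>u\<in>?U. c u * (if a = (\<lambda>j. if j \<in> T then e u j else 0) then 1 else 0))"
    unfolding hyp_poly_def summand by (intro expands_sum expands_const_mult expands_monomial T)
  also have "(\<lambda>a. \<Sum>u\<in>?U. c u * (if a = (\<lambda>j. if j \<in> T then e u j else 0) then 1 else 0)) = canonical_series T \<beta> {}"
  proof
    fix a
    have e_out: "(\<lambda>j. if j \<in> T then e u j else 0) = e u" if "u \<in> ?U" for u
      by (rule ext) (use that in \<open>auto simp: solution_exponents_def e_def in_keys_iff subset_iff\<close>)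
    have "(\<Sum>u\<in>?U. c u * (if a = (\<lambda>j. if j \<in> T then e u j else 0) then 1 else 0)) =
        (\<Sum>u\<in>?U. if a = e u then c u else 0)"
      by (intro sum.cong refl) (simp add: e_out)
    also have "\<dots> = canonical_series T \<beta> {} a"
    proof (cases "\<exists>u\<in>?U. a = e u")
      case True
      then obtain u where u: "u \<in> ?U" "a = e u" by blast
      have "a = e u' \<longleftrightarrow> u' = u" for u'
        unfolding u(2) by (auto simp: e_def fun_eq_iff intro!: poly_mapping_eqI)
      then have "(\<Sum>u\<in>?U. if a = e u then c u else 0) = c u"
        using finite_solution_exponents[OF T] u(1) by simp
      also have "\<dots> = (\<Prod>j\<in>T. inv_fact (a j))"
        by (simp add: c_def u(2) e_def inv_fact_def)
      also have "\<dots> = canonical_series T \<beta> {} a"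
      proof -
        have "mat_vec T a = \<beta>" "{j \<in> T. a j < 0} = {}" "\<And>j. j \<notin> T \<Longrightarrow> a j = 0"
          using u by (auto simp: solution_exponents_def e_def[abs_def] in_keys_iff)
        then show ?thesis by (simp add: canonical_series_def)
      qed
      finally show ?thesis .
    next
      case False
      have "canonical_series T \<beta> {} a = 0"
      proof (rule ccontr)
        assume "canonical_series T \<beta> {} a \<noteq> 0"
        then have a: "\<And>j. j \<notin> T \<Longrightarrow> a j = 0" "mat_vec T a = \<beta>" "{j \<in> T. a j < 0} = {}"
          unfolding canonical_series_def by metis+
        define u where "u = Abs_poly_mapping (\<lambda>j. nat (a j))"
        have "{j. nat (a j) \<noteq> 0} \<subseteq> T" using a(1) by force
        then have "finite {j. nat (a j) \<noteq> 0}" using T by (rule finite_subset)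
        then have lu: "Poly_Mapping.lookup u = (\<lambda>j. nat (a j))"
          by (simp add: u_def Abs_poly_mapping_inverse)
        have "a = e u"
        proof
          fix j show "a j = e u j" using a(1)[of j] a(3) by (cases "j \<in> T") (auto simp: e_def lu)
        qed
        moreover have "u \<in> ?U"
          using a(1,2) \<open>a = e u\<close> by (auto simp: solution_exponents_def e_def[abs_def] in_keys_iff)
        ultimately show False using False by blast
      qed
      moreover have "(\<Sum>u\<in>?U. if a = e u then c u else 0) = 0"
        using False by (intro sum.neutral) auto
      ultimately show ?thesis by simp
    qed
    finally show "(\<Sum>u\<in>?U. c u * (if a = (\<lambda>j. if j \<in> T then e u j else 0) then 1 else 0)) = canonical_series T \<beta> {} a" .
  qed
  finally show ?thesis .
qed

text \<open>
  The index \<open>r\<close> of the sum is minus the exponent of \<open>x\<^sub>z\<close>. Stated for an arbitrary column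
  \<open>z\<close>, this covers \<open>\<Psi>\<^sub>0\<close> and \<open>\<Psi>\<^sub>d\<close> at once. A vanishing
  \<open>hyp_poly\<close> has a vanishing expansion, so leaving out the corresponding terms is harmless.
\<close>

lemma expands_Psi:
  fixes \<alpha> :: "int \<times> int"
  assumes T: "finite T" "z \<in> T"
    and \<beta>_def: "\<And>r. \<beta> r = (fst \<alpha> + int r, snd \<alpha> + int r * int z)"
    and fin: "finite {r. r \<ge> 1 \<and> hyp_poly (T - {z}) (\<beta> r) \<noteq> 0}"
  shows "expands (\<Sum>r | r \<ge> 1 \<and> hyp_poly (T - {z}) (\<beta> r) \<noteq> 0.
      (- 1) ^ r * of_nat (fact (r - 1)) * hyp_poly (T - {z}) (\<beta> r) / rf_var z ^ r)
    (canonical_series T \<alpha> {z})"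
proof -
  define R where "R = {r. r \<ge> 1 \<and> hyp_poly (T - {z}) (\<beta> r) \<noteq> 0}"
  define c :: "nat \<Rightarrow> complex" where "c r = (- 1) ^ r * fact (r - 1)" for r
  let ?G = "\<lambda>r. canonical_series (T - {z}) (\<beta> r) {}"
  have G: "expands (hyp_poly (T - {z}) (\<beta> r)) (?G r)" for r
    using T by (intro expands_hyp_poly) simp
  have "(- 1) ^ r * of_nat (fact (r - 1)) * hyp_poly (T - {z}) (\<beta> r) / rf_var z ^ r =
      rf_const (c r) * (hyp_poly (T - {z}) (\<beta> r) * rf_var z powi (- int r))" for r
  proof -
    have "rf_const (c r) = (- 1) ^ r * of_nat (fact (r - 1))"
      unfolding c_def rf_const_mult rf_const_power rf_const_minus
      by (simp flip: rf_const_of_nat)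
    then show ?thesis by (simp add: power_int_minus divide_inverse mult.assoc)
  qed
  then have "expands (\<Sum>r\<in>R. (- 1) ^ r * of_nat (fact (r - 1)) * hyp_poly (T - {z}) (\<beta> r) / rf_var z ^ r)
      (\<lambda>a. \<Sum>r\<in>R. c r * ?G r (a(z := a z - (- int r))))"
    by (simp only:) (intro expands_sum expands_const_mult expands_var_powi G)
  also have "(\<lambda>a. \<Sum>r\<in>R. c r * ?G r (a(z := a z - (- int r)))) = canonical_series T \<alpha> {z}"
  proof
    fix a
    define r0 where "r0 = nat (- a z)"
    have other: "?G r (a(z := a z - (- int r))) = 0" if "a z + int r \<noteq> 0" for r
      using that by (auto simp: canonical_series_def)
    show "(\<Sum>r\<in>R. c r * ?G r (a(z := a z - (- int r)))) = canonical_series T \<alpha> {z} a"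
    proof (cases "a z < 0")
      case False
      have "(\<Sum>r\<in>R. c r * ?G r (a(z := a z - (- int r)))) = 0"
        using False by (intro sum.neutral ballI) (subst other, auto simp: R_def)
      moreover have "z \<notin> {j \<in> T. a j < 0}" using False by simp
      then have "canonical_series T \<alpha> {z} a = 0" by (auto simp: canonical_series_def)
      ultimately show ?thesis by simp
    next
      case True
      then have r0: "int r0 = - a z" "r0 \<ge> 1" by (simp_all add: r0_def)
      have split: "(\<Sum>j\<in>T. g j) = g z + (\<Sum>j\<in>T - {z}. g j)" for g :: "nat \<Rightarrow> int"
        using T by (rule sum.remove)
      have A: "mat_vec (T - {z}) (a(z := 0)) = \<beta> r0 \<longleftrightarrow> mat_vec T a = \<alpha>"
      proof -
        have "(\<Sum>j\<in>T - {z}. (a(z := 0)) j) = (\<Sum>j\<in>T - {z}. a j)"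
          "(\<Sum>j\<in>T - {z}. int j * (a(z := 0)) j) = (\<Sum>j\<in>T - {z}. int j * a j)"
          by (intro sum.cong refl; simp)+
        then show ?thesis
          unfolding mat_vec_def \<beta>_def r0(1) split by (cases \<alpha>) (auto simp: algebra_simps)
      qed
      have B: "{j \<in> T - {z}. (a(z := 0)) j < 0} = {} \<longleftrightarrow> {j \<in> T. a j < 0} = {z}"
        using True T(2) by auto
      have C: "(\<forall>j. j \<notin> T - {z} \<longrightarrow> (a(z := 0)) j = 0) \<longleftrightarrow> (\<forall>j. j \<notin> T \<longrightarrow> a j = 0)"
        using T(2) by auto
      have D: "(\<Prod>j\<in>T. inv_fact (a j)) = c r0 * (\<Prod>j\<in>T - {z}. inv_fact ((a(z := 0)) j))"
      proof -
        have "inv_fact (a z) = c r0" using True by (simp add: inv_fact_def c_def r0_def)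
        moreover have "(\<Prod>j\<in>T - {z}. inv_fact ((a(z := 0)) j)) = (\<Prod>j\<in>T - {z}. inv_fact (a j))"
          by (intro prod.cong refl) simp
        ultimately show ?thesis using prod.remove[OF T, of "\<lambda>j. inv_fact (a j)"] by simp
      qed
      have val: "canonical_series T \<alpha> {z} a = c r0 * ?G r0 (a(z := 0))"
        unfolding canonical_series_def A B C D by auto
      have "(\<Sum>r\<in>R. c r * ?G r (a(z := a z - (- int r)))) = (\<Sum>r\<in>R. if r = r0 then c r0 * ?G r0 (a(z := 0)) else 0)"
      proof (rule sum.cong)
        fix r
        show "c r * ?G r (a(z := a z - (- int r))) = (if r = r0 then c r0 * ?G r0 (a(z := 0)) else 0)"
        proof (cases "r = r0")
          case False
          then show ?thesis using r0(1) by (subst other) auto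
        qed (simp add: r0(1))
      qed simp
      also have "\<dots> = (if r0 \<in> R then c r0 * ?G r0 (a(z := 0)) else 0)"
        using fin by (simp add: R_def)
      also have "\<dots> = c r0 * ?G r0 (a(z := 0))"
      proof (cases "r0 \<in> R")
        case False
        then have "hyp_poly (T - {z}) (\<beta> r0) = 0" using r0(2) by (simp add: R_def)
        then have "?G r0 = (\<lambda>_. 0)" using expands_unique[OF _ expands_zero] G[of r0] by simp
        with False show ?thesis by simp
      qed simp
      finally show ?thesis using val by simp
    qed
  qed
  finally show ?thesis by (simp only: R_def)
qed

end

section \<open>Classification of the rational solutions\<close>

lemma digits_unique:
  fixes x y :: "nat \<Rightarrow> int"
  assumes "finite J" "inj_on \<pi> J" "\<And>j. j \<in> J \<Longrightarrow> 0 \<le> x j \<and> x j < W" "\<And>j. j \<in> J \<Longrightarrow> 0 \<le> y j \<and> y j < W"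
    and "(\<Sum>j\<in>J. W ^ \<pi> j * x j) = (\<Sum>j\<in>J. W ^ \<pi> j * y j)"
  shows "\<forall>j\<in>J. x j = y j"
  using assms
proof (induction J rule: finite_ranking_induct[where f = "\<lambda>j. - int (\<pi> j)"])
  case (insert k J)
  show ?case
  proof (cases "k \<in> J")
    case True
    then show ?thesis using insert by (simp add: insert_absorb)
  next
    case False
    have W: "W > 0" using insert.prems(2)[of k] by simp
    have "W ^ Suc (\<pi> k) dvd W ^ \<pi> j * (y j - x j)" if "j \<in> J" for j
    proof -
      have "\<pi> k \<le> \<pi> j" "\<pi> k \<noteq> \<pi> j" using insert.hyps(2)[OF that] insert.prems(1) False that by (auto simp: inj_on_def)
      then have "Suc (\<pi> k) \<le> \<pi> j" by simp
      then show ?thesis using le_imp_power_dvd dvd_mult2 by blast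
    qed
    then have "W ^ Suc (\<pi> k) dvd (\<Sum>j\<in>J. W ^ \<pi> j * (y j - x j))" by (rule dvd_sum)
    moreover have "(\<Sum>j\<in>J. W ^ \<pi> j * (y j - x j)) = W ^ \<pi> k * (x k - y k)"
      using insert.hyps(1) insert.prems(4) False by (simp add: right_diff_distrib sum_subtractf)
    ultimately have "W ^ \<pi> k * W dvd W ^ \<pi> k * (x k - y k)" by (simp add: mult.commute)
    then have "W dvd x k - y k" using W by simp
    moreover have "\<bar>x k - y k\<bar> < W" using insert.prems(2,3)[of k] by auto
    ultimately have "x k = y k" using dvd_imp_le_int[of "x k - y k" W] W by fastforce
    moreover have "(\<Sum>j\<in>J. W ^ \<pi> j * x j) = (\<Sum>j\<in>J. W ^ \<pi> j * y j)"
      using insert.hyps(1) insert.prems(4) False \<open>x k = y k\<close> by simp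
    then have "\<forall>j\<in>J. x j = y j"
      using insert.prems(1-3) by (intro insert.IH) auto
    ultimately show ?thesis by simp
  qed
qed simp

text \<open>
  The second condition makes \<open>dir d k\<close> a direction of increasing weight: the interior variables
  count as small in comparison with \<open>x\<^sub>0\<close> and \<open>x\<^sub>d\<close>. The third one separates
  the monomials of \<open>q\<close>, also after some of the variables have been disregarded.
\<close>

definition generic_weight :: "nat set \<Rightarrow> nat \<Rightarrow> mpol \<Rightarrow> (nat \<Rightarrow> int) \<Rightarrow> bool" where
  "generic_weight S d q w \<longleftrightarrow> (\<forall>j. w j \<ge> 0) \<and>
    (\<forall>k. 0 < k \<longrightarrow> k < d \<longrightarrow> (int d - int k) * w 0 + int k * w d < int d * w k) \<and>
    (\<forall>J b b' j. J \<subseteq> S \<longrightarrow> b \<in> Poly_Mapping.keys q \<longrightarrow> b' \<in> Poly_Mapping.keys q \<longrightarrow>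
      wdeg J w (\<lambda>j. int (Poly_Mapping.lookup b j)) = wdeg J w (\<lambda>j. int (Poly_Mapping.lookup b' j)) \<longrightarrow>
      j \<in> J \<longrightarrow> Poly_Mapping.lookup b j = Poly_Mapping.lookup b' j)"

text \<open>
  With powers of a large base \<open>W\<close> as weights, the exponents of \<open>q\<close> become digit expansions.
  Giving \<open>x\<^sub>0\<close> and \<open>x\<^sub>d\<close> the two lowest digits yields the second condition.
\<close>

lemma generic_weight_exists:
  fixes q :: mpol
  assumes "finite S" "d > 0" and S: "\<And>j. j \<in> S \<Longrightarrow> j \<le> d"
  shows "\<exists>w. generic_weight S d q w"
proof -
  define W :: int where "W = 2 + int (\<Sum>b\<in>Poly_Mapping.keys q. \<Sum>j\<in>S. Poly_Mapping.lookup b j)"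
  define \<pi> where "\<pi> j = (if j = 0 then 0 else if j = d then 1 else j + 1)" for j
  have W: "W \<ge> 2" by (simp add: W_def sum_nonneg)
  have digit: "0 \<le> int (Poly_Mapping.lookup b j) \<and> int (Poly_Mapping.lookup b j) < W"
    if "b \<in> Poly_Mapping.keys q" "j \<in> S" for b j
  proof -
    have "Poly_Mapping.lookup b j \<le> (\<Sum>j\<in>S. Poly_Mapping.lookup b j)"
      using that(2) assms(1) by (intro member_le_sum) auto
    also have "\<dots> \<le> (\<Sum>b\<in>Poly_Mapping.keys q. \<Sum>j\<in>S. Poly_Mapping.lookup b j)"
      using that(1) by (intro member_le_sum[of b _ "\<lambda>b. \<Sum>j\<in>S. Poly_Mapping.lookup b j"]) auto
    finally show ?thesis unfolding W_def by linarith
  qed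
  have inj: "inj_on \<pi> S" using S by (auto simp: inj_on_def \<pi>_def split: if_splits)
  show ?thesis
    unfolding generic_weight_def
  proof (intro exI[of _ "\<lambda>j. W ^ \<pi> j"] conjI allI impI)
    show "W ^ \<pi> j \<ge> 0" for j using W by simp
  next
    fix k assume k: "0 < k" "k < d"
    have "(int d - int k) * 1 \<le> (int d - int k) * W" using k W by (intro mult_left_mono) auto
    then have "(int d - int k) * W ^ \<pi> 0 + int k * W ^ \<pi> d \<le> int d * W"
      using assms(2) by (simp add: \<pi>_def algebra_simps)
    also have "\<dots> < int d * W ^ \<pi> k"
    proof -
      have "W ^ 1 < W ^ \<pi> k" using W k by (intro power_strict_increasing) (auto simp: \<pi>_def)
      then show ?thesis using assms(2) by simp
    qed
    finally show "(int d - int k) * W ^ \<pi> 0 + int k * W ^ \<pi> d < int d * W ^ \<pi> k" .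
  next
    fix J b b' j
    assume J: "J \<subseteq> S" and b: "b \<in> Poly_Mapping.keys q" "b' \<in> Poly_Mapping.keys q"
      and eq: "wdeg J (\<lambda>j. W ^ \<pi> j) (\<lambda>j. int (Poly_Mapping.lookup b j)) =
        wdeg J (\<lambda>j. W ^ \<pi> j) (\<lambda>j. int (Poly_Mapping.lookup b' j))" and j: "j \<in> J"
    have "\<forall>j\<in>J. int (Poly_Mapping.lookup b j) = int (Poly_Mapping.lookup b' j)"
    proof (rule digits_unique)
      show "finite J" using J assms(1) by (rule finite_subset)
      show "inj_on \<pi> J" using inj J by (rule inj_on_subset)
      show "(\<Sum>j\<in>J. W ^ \<pi> j * int (Poly_Mapping.lookup b j)) = (\<Sum>j\<in>J. W ^ \<pi> j * int (Poly_Mapping.lookup b' j))"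
        using eq by (simp only: wdeg_def)
    qed (use digit b J in blast)+
    then show "Poly_Mapping.lookup b j = Poly_Mapping.lookup b' j" using j by simp
  qed
qed

text \<open>
  By the bounds on the support at most one coordinate is negative, and only at an end point; this
  leaves the three canonical series.
\<close>

lemma (in curve) rational_solution_structure:
  assumes k: "k \<in> S" "0 < k" "k < d"
    and rat: "\<phi> \<in> ratfuns S" and sol: "hypergeometric_solution S \<alpha> \<phi>"
  obtains w f c where "weighted.expands S w \<phi> f" "hypergeometric_series S \<alpha> f"
    "finite {a. f a \<noteq> 0}"
    "f = (\<lambda>a. c {} * canonical_series S \<alpha> {} a + c {0} * canonical_series S \<alpha> {0} a +
      c {d} * canonical_series S \<alpha> {d} a)"
proof -
  obtain p q where pq: "\<phi> = Fract p q" "q \<noteq> 0" "mvars p \<subseteq> S" "mvars q \<subseteq> S"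
    using rat by (auto simp: ratfuns_def)
  obtain w where gw: "generic_weight S d q w"
    using generic_weight_exists[OF finite d_pos le_d] by blast
  have w: "w j \<ge> 0" "0 < k \<Longrightarrow> k < d \<Longrightarrow> (int d - int k) * w 0 + int k * w d < int d * w k" for j k
    using gw unfolding generic_weight_def by blast+
  have generic: "Poly_Mapping.lookup b j = Poly_Mapping.lookup b' j"
    if "J \<subseteq> S" "b \<in> Poly_Mapping.keys q" "b' \<in> Poly_Mapping.keys q"
      "wdeg J w (\<lambda>j. int (Poly_Mapping.lookup b j)) = wdeg J w (\<lambda>j. int (Poly_Mapping.lookup b' j))"
      "j \<in> J" for J b b' j
    using gw that unfolding generic_weight_def by blast
  interpret weighted S w .
  let ?wt = "\<lambda>b. wdeg S w (\<lambda>j. int (Poly_Mapping.lookup b j))"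
  let ?W = "?wt ` Poly_Mapping.keys q"
  have W: "finite ?W" "?W \<noteq> {}" using pq(2) by auto
  obtain b0 where b0: "b0 \<in> Poly_Mapping.keys q" "Min ?W = ?wt b0" using Min_in[OF W] by auto
  have min: "?wt b0 < ?wt b" if b: "b \<in> Poly_Mapping.keys q" "b \<noteq> b0" for b
  proof -
    have "?wt b0 \<le> ?wt b" unfolding b0(2)[symmetric] using b(1) by (intro Min_le[OF W(1)] imageI)
    moreover have "?wt b0 \<noteq> ?wt b"
    proof
      assume eq: "?wt b0 = ?wt b"
      have "Poly_Mapping.lookup b0 j = Poly_Mapping.lookup b j" for j
      proof (cases "j \<in> S")
        case True
        then show ?thesis using generic[OF subset_refl b0(1) b(1) eq] by simp
      next
        case False
        then have "j \<notin> Poly_Mapping.keys b" "j \<notin> Poly_Mapping.keys b0"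
          using pq(4) b(1) b0(1) by (auto simp: mvars_def)
        then show ?thesis by (simp add: in_keys_iff)
      qed
      then have "b0 = b" by (rule poly_mapping_eqI)
      with b(2) show False by simp
    qed
    ultimately show ?thesis by simp
  qed
  obtain f where f: "bounded_series f" "\<And>a j. f a \<noteq> 0 \<Longrightarrow> j \<notin> S \<Longrightarrow> a j = 0" "act q f = act p one_series"
    using expansion_exists[OF b0(1) min pq(3,4)] by blast
  have ex: "expands \<phi> f"
    using pq(2,1) cancellable_if_unique_minimum[OF b0(1) min] f(3,1) by (rule expandsI)
  have H: "hypergeometric_series S \<alpha> f"
    using finite sol ex f(2) by (rule hypergeometric_series_expansion)
  have int: "a j \<ge> 0" if "f a \<noteq> 0" "j \<in> S" "0 < j" "j < d" for a j
    using interior_nonneg[OF H f(1) w(2) that(1)] that by blast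
  have ends: "a 0 \<ge> 0 \<or> a d \<ge> 0" if "f a \<noteq> 0" for a
    using H int k pq(2,4) f(3) w(1) generic that by (rule no_doubly_negative) auto
  obtain B where B: "\<And>a. mat_vec S a = \<alpha> \<Longrightarrow> (\<forall>j\<in>S. 0 < j \<longrightarrow> j < d \<longrightarrow> a j \<ge> 0) \<Longrightarrow>
    (a 0 \<ge> 0 \<or> a d \<ge> 0) \<Longrightarrow> (\<forall>j\<in>S. \<bar>a j\<bar> \<le> B)"
    using level_bounds by blast
  have "{a. f a \<noteq> 0} \<subseteq> {a. \<forall>j. (j \<in> S \<longrightarrow> a j \<in> {- B..B}) \<and> (j \<notin> S \<longrightarrow> a j = 0)}"
  proof (intro subsetI CollectI allI conjI impI)
    fix a j assume a: "a \<in> {a. f a \<noteq> 0}"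
    have "\<forall>j\<in>S. \<bar>a j\<bar> \<le> B"
      using a by (intro B hypergeometric_series_level[OF H] ends) (auto intro: int)
    then show "a j \<in> {- B..B}" if "j \<in> S" using that by (auto simp: abs_le_iff minus_le_iff)
    show "a j = 0" if "j \<notin> S" using f(2) a that by simp
  qed
  moreover have "finite {a. \<forall>j. (j \<in> S \<longrightarrow> a j \<in> {- B..B}) \<and> (j \<notin> S \<longrightarrow> a j = 0)}"
    using finite by (intro finite_set_of_finite_funs) auto
  ultimately have fin: "finite {a. f a \<noteq> 0}" by (rule finite_subset)
  obtain c where c: "\<And>N a. {j \<in> S. a j < 0} = N \<Longrightarrow> f a = c N * canonical_series S \<alpha> N a"
    using canonical_series_coefficient[OF H finite] by metis
  have "f a = c {} * canonical_series S \<alpha> {} a + c {0} * canonical_series S \<alpha> {0} a +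
      c {d} * canonical_series S \<alpha> {d} a" for a
  proof -
    define N where "N = {j \<in> S. a j < 0}"
    have fa: "f a = c N * canonical_series S \<alpha> N a" using c[OF N_def[symmetric]] .
    have off: "canonical_series S \<alpha> N' a = 0" if "N' \<noteq> N" for N'
      using that by (simp add: canonical_series_eq_0 N_def)
    have "N \<in> {{}, {0}, {d}} \<or> f a = 0"
    proof (cases "f a = 0")
      case False
      have "N \<subseteq> {0, d}"
      proof
        fix j assume j: "j \<in> N"
        then have "j \<le> d" using le_d by (simp add: N_def)
        then show "j \<in> {0, d}" using int[OF False, of j] j by (force simp: N_def)
      qed
      moreover have "\<not> (0 \<in> N \<and> d \<in> N)" using ends[OF False] by (auto simp: N_def)
      ultimately show ?thesis by blast
    qed simp
    moreover have "{0} \<noteq> {d}" using d_pos by simp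
    ultimately consider "N = {}" | "N = {0}" "{0} \<noteq> {d}" | "N = {d}" "{0} \<noteq> {d}" | "N \<notin> {{}, {0}, {d}}" "f a = 0"
      by blast
    then show ?thesis
    proof cases
      case 4
      then have "{} \<noteq> N" "{0} \<noteq> N" "{d} \<noteq> N" by blast+
      with 4(2) show ?thesis by (simp add: off)
    qed (use fa off[of "{}"] off[of "{0}"] off[of "{d}"] in simp_all)
  qed
  then have "f = (\<lambda>a. c {} * canonical_series S \<alpha> {} a + c {0} * canonical_series S \<alpha> {0} a +
      c {d} * canonical_series S \<alpha> {d} a)" by (rule ext)
  with ex H fin show thesis by (rule that)
qed

theorem theorem1p10:
  fixes m d :: nat and k :: "nat \<Rightarrow> nat" and \<Lambda> :: "nat set"
    and \<alpha> :: "int \<times> int" and \<phi> :: ratfun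
  assumes "m \<ge> 1" and "0 < k 1" and "strict_mono_on {1..m} k" and "k m < d"
    and "Gcd (k ` {1..m} \<union> {d}) = 1"
    and "\<Lambda> = index_set m k d"
    and "\<phi> \<in> ratfuns \<Lambda>"
    and "hypergeometric_solution \<Lambda> \<alpha> \<phi>"
  shows "(\<alpha> \<in> column_monoid \<Lambda> \<longrightarrow> (\<exists>c. \<phi> = rf_const c * hyp_poly \<Lambda> \<alpha>)) \<and>
    (\<alpha> \<notin> column_monoid \<Lambda> \<longrightarrow>
       (\<exists>a b. \<phi> = rf_const a * Psi_0 \<Lambda> \<alpha> + rf_const b * Psi_d \<Lambda> d \<alpha>)) \<and>
    laurent_polynomial \<Lambda> \<phi>"
proof -
  have mono: "k i \<le> k m" if "i \<in> {1..m}" for i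
    using assms(1,3) that strict_mono_on_leD[of "{1..m}" k i m] by auto
  have k1: "k 1 \<in> \<Lambda>" "0 < k 1" "k 1 < d"
    using assms(1,2,4,6) mono[of 1] by (auto simp: index_set_def)
  interpret curve \<Lambda> d
  proof
    show "j \<le> d" if "j \<in> \<Lambda>" for j
      using that assms(4,6) mono by (force simp: index_set_def)
  qed (use k1 assms(6) in \<open>auto simp: index_set_def\<close>)
  obtain w f c where ex: "weighted.expands \<Lambda> w \<phi> f" and H: "hypergeometric_series \<Lambda> \<alpha> f"
    and fin: "finite {a. f a \<noteq> 0}"
    and f: "f = (\<lambda>a. c {} * canonical_series \<Lambda> \<alpha> {} a + c {0} * canonical_series \<Lambda> \<alpha> {0} a +
      c {d} * canonical_series \<Lambda> \<alpha> {d} a)"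
    using rational_solution_structure[OF k1 assms(7,8)] by blast
  interpret weighted \<Lambda> w .
  have Phi: "expands (hyp_poly \<Lambda> \<alpha>) (canonical_series \<Lambda> \<alpha> {})"
    using finite by (rule expands_hyp_poly)
  have Psi0: "expands (Psi_0 \<Lambda> \<alpha>) (canonical_series \<Lambda> \<alpha> {0})"
    using expands_Psi[OF finite zero_in, of "\<lambda>r. (fst \<alpha> + int r, snd \<alpha>)" \<alpha>] finite_Psi_0[of \<Lambda> \<alpha>]
    unfolding Psi_0_def by simp
  have Psid: "expands (Psi_d \<Lambda> d \<alpha>) (canonical_series \<Lambda> \<alpha> {d})"
    using expands_Psi[OF finite d_in, of "\<lambda>r. (fst \<alpha> + int r, snd \<alpha> + int r * int d)" \<alpha>] finite_Psi_d[of \<Lambda> d \<alpha>] le_d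
    unfolding Psi_d_def by simp
  have "\<exists>c. \<phi> = rf_const c * hyp_poly \<Lambda> \<alpha>" if "\<alpha> \<in> column_monoid \<Lambda>"
  proof -
    obtain u where u: "\<alpha> = mat_vec \<Lambda> (\<lambda>j. int (Poly_Mapping.lookup u j))" "Poly_Mapping.keys u \<subseteq> \<Lambda>"
      using \<open>\<alpha> \<in> column_monoid \<Lambda>\<close> by (auto simp: column_monoid_def)
    have "{j \<in> \<Lambda>. a j < 0} = {}" if nz: "f a \<noteq> 0" for a
    proof -
      have "int (Poly_Mapping.lookup u j) < 0" if "j \<in> \<Lambda>" "a j < 0" for j
        using H finite nz _ _ _ that
        by (rule hypergeometric_series_neg_support)
          (use hypergeometric_series_level[OF H nz] u in \<open>auto simp: in_keys_iff\<close>)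
      then show ?thesis by force
    qed
    then have "f = (\<lambda>a. c {} * canonical_series \<Lambda> \<alpha> {} a)"
    proof (intro ext)
      fix a
      assume neg: "\<And>a. f a \<noteq> 0 \<Longrightarrow> {j \<in> \<Lambda>. a j < 0} = {}"
      show "f a = c {} * canonical_series \<Lambda> \<alpha> {} a"
      proof (cases "{j \<in> \<Lambda>. a j < 0} = {}")
        case True
        then have "canonical_series \<Lambda> \<alpha> {0} a = 0" "canonical_series \<Lambda> \<alpha> {d} a = 0"
          by (simp_all only: canonical_series_eq_0 empty_not_insert not_False_eq_True)
        then show ?thesis by (subst f) simp
      next
        case False
        then have "f a = 0" using neg by blast
        with False show ?thesis by (simp add: canonical_series_eq_0)
      qed
    qed
    then have "expands \<phi> (\<lambda>a. c {} * canonical_series \<Lambda> \<alpha> {} a)" using ex by simp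
    then show ?thesis using expands_inj expands_const_mult[OF Phi] by blast
  qed
  moreover have "\<exists>a b. \<phi> = rf_const a * Psi_0 \<Lambda> \<alpha> + rf_const b * Psi_d \<Lambda> d \<alpha>" if "\<alpha> \<notin> column_monoid \<Lambda>"
  proof -
    have empty: "solution_exponents \<Lambda> \<alpha> = {}"
      using that by (auto simp: solution_exponents_def column_monoid_def)
    have "hyp_poly \<Lambda> \<alpha> = 0" unfolding hyp_poly_def empty by simp
    then have "canonical_series \<Lambda> \<alpha> {} = (\<lambda>_. 0)" using expands_unique Phi expands_zero by metis
    then have "f = (\<lambda>a. c {0} * canonical_series \<Lambda> \<alpha> {0} a + c {d} * canonical_series \<Lambda> \<alpha> {d} a)"
      by (simp add: f)
    then have "expands \<phi> (\<lambda>a. c {0} * canonical_series \<Lambda> \<alpha> {0} a + c {d} * canonical_series \<Lambda> \<alpha> {d} a)"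
      using ex by simp
    then show ?thesis
      using expands_inj expands_add[OF expands_const_mult[OF Psi0] expands_const_mult[OF Psid]] by blast
  qed
  moreover have "laurent_polynomial \<Lambda> \<phi>"
  proof -
    have "expands (\<Sum>e\<in>{a. f a \<noteq> 0}. rf_const (f e) * (\<Prod>j\<in>\<Lambda>. rf_var j powi e j))
        (\<lambda>a. \<Sum>e\<in>{a. f a \<noteq> 0}. f e * (if a = (\<lambda>j. if j \<in> \<Lambda> then e j else 0) then 1 else 0))"
      by (intro expands_sum expands_const_mult expands_monomial finite)
    moreover have "(\<lambda>a. \<Sum>e\<in>{a. f a \<noteq> 0}. f e * (if a = (\<lambda>j. if j \<in> \<Lambda> then e j else 0) then 1 else 0)) = f"
    proof
      fix a
      have "(\<lambda>j. if j \<in> \<Lambda> then e j else 0) = e" if "f e \<noteq> 0" for e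
        using hypergeometric_series_outside[OF H that] by auto
      then have "(\<Sum>e\<in>{a. f a \<noteq> 0}. f e * (if a = (\<lambda>j. if j \<in> \<Lambda> then e j else 0) then 1 else 0)) =
          (\<Sum>e\<in>{a. f a \<noteq> 0}. if a = e then f e else 0)"
        by (intro sum.cong refl) auto
      also have "\<dots> = f a" using fin by simp
      finally show "(\<Sum>e\<in>{a. f a \<noteq> 0}. f e * (if a = (\<lambda>j. if j \<in> \<Lambda> then e j else 0) then 1 else 0)) = f a" .
    qed
    ultimately have "expands (\<Sum>e\<in>{a. f a \<noteq> 0}. rf_const (f e) * (\<Prod>j\<in>\<Lambda>. rf_var j powi e j)) f"
      by (simp only:)
    note expands_inj[OF ex this]
    then show ?thesis unfolding laurent_polynomial_def using fin by blast
  qed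
  ultimately show ?thesis by blast
qed

end
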